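(* Let $H$ denote either the algebra $A_u$ or the algebra $H^\infty$. Let $Y$ be a complex Banach space and $(Y_\alpha)_{\alpha\in A}$ a family of finite dimensional subspaces of $Y$ that is directed by inclusion and whose union is dense in $Y$. If $(\sum_{\alpha\in A}Y_\alpha)_1$ satisfies the cluster value theorem for $H$, then so does $Y$.
   Context: All Banach spaces are complex. For a Banach space $X$, $B_X$ denotes its open unit ball. $H^\infty(B_X)$ is the Banach algebra (sup norm over $B_X$, pointwise operations) of all bounded analytic functions $f:B_X\to\mathbb{C}$, and $A_u(B_X)$ is the subalgebra of those $f\in H^\infty(B_X)$ that are uniformly continuous on $B_X$. Elements of $X^*$ are regarded as elements of these algebras by restriction to $B_X$. $(\sum_{\alpha\in A}Y_\alpha)_1$ is the $\ell_1$ sum: the Banach space of all families $(z_\alpha)_{\alpha\in A}$ with $z_\alpha\in Y_\alpha$ and $\|(z_\alpha)\|=\sum_{\alpha}\|z_\alpha\|<\infty$. Directed by inclusion means that any two members of the family are contained in a third member. Let $H(B_X)$ be one of the two algebras and let $x^{**}$ be in the closed unit ball of $X^{**}$. For $f\in H(B_X)$, the cluster set $Cl_{B_X}(f,x^{**})\subset\mathbb{C}$ is the set of all limits of $f(x_\beta)$ along nets $(x_\beta)$ in $B_X$ that converge to $x^{**}$ in the weak$^*$ topology of $X^{**}$. $M_{x^{**}}(B_X)$ is the set of (nonzero) multiplicative linear functionals $\tau$ on $H(B_X)$ such that $\tau(x^* )=\langle x^{**},x^*\rangle$ for all $x^*\in X^*$. $H(B_X)$ satisfies the cluster value theorem at $x^{**}$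 if for every $f\in H(B_X)$ one has $\{\tau(f):\tau\in M_{x^{**}}(B_X)\}\subset Cl_{B_X}(f,x^{**})$. The space $X$ satisfies the cluster value theorem for $H$ if $H(B_X)$ satisfies the cluster value theorem at every $x^{**}$ in the closed unit ball of $X^{**}$. *)

theory Defs
  imports "HOL-Analysis.Analysis" "HOL-Library.Function_Algebras"
begin

text \<open>
  The \<open>\<ell>\<^sub>1\<close> sum of a family of subspaces depends on the family and hence cannot be a type.
  A complex normed space is therefore a subspace (the carrier) of an ambient complex vector
  space, with a norm that matters only on the carrier. An arbitrary complex Banach space is the
  case where the carrier is the whole ambient space.
\<close>

record 'v cspace =
  carrier :: "'v set"
  smult :: "complex \<Rightarrow> 'v \<Rightarrow> 'v"
  nrm :: "'v \<Rightarrow> real"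

text \<open>
  The library locale for metric spaces requires symmetry and nonnegativity also off the carrier,
  where \<open>nrm\<close> is unconstrained; hence the value 0 there.
\<close>

definition ndist :: "('v::ab_group_add) cspace \<Rightarrow> 'v \<Rightarrow> 'v \<Rightarrow> real" where
  "ndist X x y = (if x \<in> carrier X \<and> y \<in> carrier X then nrm X (x - y) else 0)"

definition complex_normed_space :: "('v::ab_group_add) cspace \<Rightarrow> bool" where
  "complex_normed_space X \<longleftrightarrow>
     vector_space (smult X) \<and> module.subspace (smult X) (carrier X) \<and>
     (\<forall>x\<in>carrier X. 0 \<le> nrm X x \<and> (nrm X x = 0 \<longleftrightarrow> x = 0)) \<and>
     (\<forall>x\<in>carrier X. \<forall>y\<in>carrier X. nrm X (x + y) \<le> nrm X x + nrm X y) \<and>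
     (\<forall>c. \<forall>x\<in>carrier X. nrm X (smult X c x) = cmod c * nrm X x)"

definition complex_banach_space :: "('v::ab_group_add) cspace \<Rightarrow> bool" where
  "complex_banach_space X \<longleftrightarrow>
     complex_normed_space X \<and> Metric_space.mcomplete (carrier X) (ndist X)"

definition unit_ball :: "('v::ab_group_add) cspace \<Rightarrow> 'v set" where
  "unit_ball X = {x \<in> carrier X. nrm X x < 1}"

definition closed_unit_ball :: "('v::ab_group_add) cspace \<Rightarrow> 'v set" where
  "closed_unit_ball X = {x \<in> carrier X. nrm X x \<le> 1}"

definition finite_dim_subspace :: "('v::ab_group_add) cspace \<Rightarrow> 'v set \<Rightarrow> bool" where
  "finite_dim_subspace X S \<longleftrightarrow>
     module.subspace (smult X) S \<and> S \<subseteq> carrier X \<and>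
     (\<exists>B. finite B \<and> module.span (smult X) B = S)"

text \<open>
  Functions whose domain is only a subset of a type (functionals on a carrier, functions on the
  unit ball) are normalized to vanish off that subset, so that equal functions are equal as HOL
  functions. In particular the dual is again a \<open>cspace\<close>, and \<open>dual (dual X)\<close> is the bidual.
\<close>

definition dual :: "('v::ab_group_add) cspace \<Rightarrow> ('v \<Rightarrow> complex) cspace" where
  "dual X = \<lparr>
     carrier = {\<phi>. (\<forall>x\<in>carrier X. \<forall>y\<in>carrier X. \<phi> (x + y) = \<phi> x + \<phi> y) \<and>
                   (\<forall>c. \<forall>x\<in>carrier X. \<phi> (smult X c x) = c * \<phi> x) \<and>
                   (\<exists>K. \<forall>x\<in>carrier X. cmod (\<phi> x) \<le> K * nrm X x) \<and>
                   (\<forall>x. x \<notin> carrier X \<longrightarrow> \<phi> x = 0)},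
     smult = (\<lambda>c \<phi> x. c * \<phi> x),
     nrm = (\<lambda>\<phi>. SUP x\<in>closed_unit_ball X. cmod (\<phi> x)) \<rparr>"

definition ell1_sum :: "('v::ab_group_add) cspace \<Rightarrow> 'a set \<Rightarrow> ('a \<Rightarrow> 'v set) \<Rightarrow> ('a \<Rightarrow> 'v) cspace" where
  "ell1_sum Y A F = \<lparr>
     carrier = {z. (\<forall>\<alpha>\<in>A. z \<alpha> \<in> F \<alpha>) \<and> (\<forall>\<alpha>. \<alpha> \<notin> A \<longrightarrow> z \<alpha> = 0) \<and>
                   (\<lambda>\<alpha>. nrm Y (z \<alpha>)) summable_on A},
     smult = (\<lambda>c z \<alpha>. smult Y c (z \<alpha>)),
     nrm = (\<lambda>z. \<Sum>\<^sub>\<infinity>\<alpha>\<in>A. nrm Y (z \<alpha>)) \<rparr>"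

text \<open>Analytic means complex Frechet differentiable at every point of the open unit ball.\<close>

definition analytic_on_ball :: "('v::ab_group_add) cspace \<Rightarrow> ('v \<Rightarrow> complex) \<Rightarrow> bool" where
  "analytic_on_ball X f \<longleftrightarrow>
     (\<forall>x\<in>unit_ball X. \<exists>D\<in>carrier (dual X). \<forall>e>0. \<exists>d>0. \<forall>y\<in>unit_ball X.
        ndist X y x < d \<longrightarrow> cmod (f y - f x - D (y - x)) \<le> e * ndist X y x)"

definition Hinf_algebra :: "('v::ab_group_add) cspace \<Rightarrow> ('v \<Rightarrow> complex) set" where
  "Hinf_algebra X =
     {f. analytic_on_ball X f \<and> bounded (f ` unit_ball X) \<and> (\<forall>x. x \<notin> unit_ball X \<longrightarrow> f x = 0)}"

definition Au_algebra :: "('v::ab_group_add) cspace \<Rightarrow> ('v \<Rightarrow> complex) set" where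
  "Au_algebra X =
     {f \<in> Hinf_algebra X. \<forall>e>0. \<exists>d>0. \<forall>x\<in>unit_ball X. \<forall>y\<in>unit_ball X.
        ndist X x y < d \<longrightarrow> cmod (f x - f y) < e}"

datatype ball_algebra = Au | Hinf

fun algebra_on :: "ball_algebra \<Rightarrow> ('v::ab_group_add) cspace \<Rightarrow> ('v \<Rightarrow> complex) set" where
  "algebra_on Au X = Au_algebra X"
| "algebra_on Hinf X = Hinf_algebra X"

definition restrict_ball :: "('v::ab_group_add) cspace \<Rightarrow> ('v \<Rightarrow> complex) \<Rightarrow> ('v \<Rightarrow> complex)" where
  "restrict_ball X \<phi> = (\<lambda>x. if x \<in> unit_ball X then \<phi> x else 0)"

text \<open>Only the values of \<open>\<tau>\<close> on the algebra matter.\<close>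

definition multiplicative_functional ::
  "ball_algebra \<Rightarrow> ('v::ab_group_add) cspace \<Rightarrow> (('v \<Rightarrow> complex) \<Rightarrow> complex) \<Rightarrow> bool" where
  "multiplicative_functional H X \<tau> \<longleftrightarrow>
     (\<forall>f\<in>algebra_on H X. \<forall>g\<in>algebra_on H X. \<tau> (\<lambda>x. f x + g x) = \<tau> f + \<tau> g) \<and>
     (\<forall>c. \<forall>f\<in>algebra_on H X. \<tau> (\<lambda>x. c * f x) = c * \<tau> f) \<and>
     (\<forall>f\<in>algebra_on H X. \<forall>g\<in>algebra_on H X. \<tau> (\<lambda>x. f x * g x) = \<tau> f * \<tau> g) \<and>
     (\<exists>f\<in>algebra_on H X. \<tau> f \<noteq> 0)"

definition fiber ::
  "ball_algebra \<Rightarrow> ('v::ab_group_add) cspace \<Rightarrow> (('v \<Rightarrow> complex) \<Rightarrow> complex) \<Rightarrow>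
   (('v \<Rightarrow> complex) \<Rightarrow> complex) set" where
  "fiber H X \<xi> =
     {\<tau>. multiplicative_functional H X \<tau> \<and>
         (\<forall>\<phi>\<in>carrier (dual X). \<tau> (restrict_ball X \<phi>) = \<xi> \<phi>)}"

text \<open>
  A net is represented by the filter generated by its tails; the tail filters of nets
  in the unit ball are exactly the proper filters containing the unit ball. The second condition is weak-star
  convergence, in the bidual, of the net to \<open>\<xi>\<close>.
\<close>

definition cluster_set ::
  "('v::ab_group_add) cspace \<Rightarrow> ('v \<Rightarrow> complex) \<Rightarrow> (('v \<Rightarrow> complex) \<Rightarrow> complex) \<Rightarrow> complex set" where
  "cluster_set X f \<xi> =
     {w. \<exists>N. N \<noteq> bot \<and> N \<le> principal (unit_ball X) \<and>
             (\<forall>\<phi>\<in>carrier (dual X). (\<phi> \<longlongrightarrow> \<xi> \<phi>) N) \<and> (f \<longlongrightarrow> w) N}"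

definition cluster_value_theorem_at ::
  "ball_algebra \<Rightarrow> ('v::ab_group_add) cspace \<Rightarrow> (('v \<Rightarrow> complex) \<Rightarrow> complex) \<Rightarrow> bool" where
  "cluster_value_theorem_at H X \<xi> \<longleftrightarrow>
     (\<forall>f\<in>algebra_on H X. {\<tau> f | \<tau>. \<tau> \<in> fiber H X \<xi>} \<subseteq> cluster_set X f \<xi>)"

definition satisfies_cluster_value_theorem ::
  "ball_algebra \<Rightarrow> ('v::ab_group_add) cspace \<Rightarrow> bool" where
  "satisfies_cluster_value_theorem H X \<longleftrightarrow>
     (\<forall>\<xi>\<in>closed_unit_ball (dual (dual X)). cluster_value_theorem_at H X \<xi>)"

end

theory Submission
  imports Defs "HOL-Complex_Analysis.Cauchy_Integral_Formula"
begin

text \<open>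
  Let \<open>X\<close> be the \<open>\<ell>\<^sub>1\<close> sum. The summation map \<open>Q: X \<rightarrow> Y\<close>, \<open>z \<mapsto> \<Sum>\<alpha>. z \<alpha>\<close>, is a linear contraction, so
  \<open>f \<mapsto> f \<circ> Q\<close> sends \<open>H(B\<^sub>Y)\<close> into \<open>H(B\<^sub>X)\<close>. The theorem holds because this map has a multiplicative left
  inverse \<open>T\<close>, obtained by approximating points of \<open>Y\<close> from the subspaces \<open>F \<alpha>\<close>.
  
  For \<open>y\<close> in \<open>Y\<close> and an index \<open>k = (\<alpha>, n)\<close>, let \<open>J\<^sub>k y\<close> be an element of \<open>F \<alpha>\<close> that is within \<open>1/(n+1)\<close> of
  being a best approximation of \<open>y\<close>, placed in coordinate \<open>\<alpha>\<close> of \<open>X\<close>. As \<open>\<alpha>\<close> and \<open>n\<close> grow, the maps \<open>J\<^sub>k\<close> are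
  asymptotically linear and isometric and \<open>Q (J\<^sub>k y)\<close> tends to \<open>y\<close>. Compactness of a product of discs
  provides a filter \<open>N\<close> on the indices, finer than the filter of tails, along which every bounded complex net
  converges (\<open>convergence_deciding_filter\<close>; it does the work of an ultrafilter). Put
  \<open>(T g)(y) = lim\<^sub>N g (J\<^sub>k y)\<close>. Limits respect sums and products, so \<open>T\<close> is multiplicative, and
  \<open>T (f \<circ> Q) = f\<close> because \<open>f\<close> is continuous (\<open>push_pull\<close>).
  
  The analytic content is that \<open>T g\<close> is again analytic (\<open>push_analytic\<close>). Cauchy's estimates on complex lines
  bound the first derivative of \<open>g\<close> and its second order Taylor remainder by constants that depend only on
  \<open>sup |g|\<close> and the distance to the unit sphere. These bounds survive the limit along \<open>N\<close>; the uniform bound on the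
  first derivative also makes the limit insensitive to the failure of \<open>J\<^sub>k\<close> to be linear.
  
  On functionals \<open>T\<close> induces a contraction \<open>S: X\<^sup>* \<rightarrow> Y\<^sup>*\<close> with \<open>S (\<phi> \<circ> Q) = \<phi>\<close>. If \<open>\<tau>\<close> lies in the fiber over
  \<open>\<xi>\<close>, then \<open>\<tau> \<circ> T\<close> lies in the fiber over \<open>\<xi> \<circ> S\<close>, and the cluster value theorem for \<open>X\<close> gives
  \<open>\<tau> f = (\<tau> \<circ> T) (f \<circ> Q) \<in> Cl (f \<circ> Q, \<xi> \<circ> S)\<close>. Finally \<open>Q\<close> carries a net witnessing this to a net that
  converges to \<open>\<xi>\<close>, since \<open>(\<xi> \<circ> S) (\<phi> \<circ> Q) = \<xi> \<phi>\<close>; hence \<open>\<tau> f \<in> Cl (f, \<xi>)\<close>.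
\<close>

section \<open>Filters along which all bounded nets converge\<close>

text \<open>
  The index \<open>k\<close> is mapped to the evaluation of all bounded functions at \<open>k\<close>, a point of a product of discs, which is
  compact by Tychonoff's theorem. The filter is the trace on \<open>F\<close> of the neighbourhoods of a cluster point.
\<close>
lemma convergence_deciding_filter:
  fixes F :: "'i filter"
  assumes "F \<noteq> bot"
  obtains N where "N \<le> F" "N \<noteq> bot"
    "\<And>u :: 'i \<Rightarrow> complex. bounded (range u) \<Longrightarrow> \<exists>l. (u \<longlongrightarrow> l) N"
proof -
  \<comment> \<open>Unbounded functions are sent to 0, so that every coordinate ranges in a disc.\<close>
  define \<Phi> where "\<Phi> k u = (if bounded (range u) then u k else 0)" for k :: 'i and u :: "'i \<Rightarrow> complex"
  have "\<exists>B\<ge>0. \<forall>k. cmod (\<Phi> k u) \<le> B" for u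
  proof (cases "bounded (range u)")
    case True
    then show ?thesis
      by (auto simp: \<Phi>_def bounded_pos intro: less_imp_le)
  qed (auto simp: \<Phi>_def)
  then obtain B where B: "\<And>u k. cmod (\<Phi> k u) \<le> B u"
    by metis
  define K where "K = (\<Pi>\<^sub>E u\<in>UNIV. cball (0::complex) (B u))"
  have "compact K"
    using compactin_PiE[where I = UNIV and X = "\<lambda>_. euclidean" and S = "\<lambda>u. cball (0::complex) (B u)"]
    by (simp add: K_def euclidean_product_topology)
  moreover have "\<Phi> k \<in> K" for k
    using B by (auto simp: K_def)
  then have "eventually (\<lambda>p. p \<in> K) (filtermap \<Phi> F)"
    by (simp add: eventually_filtermap)
  moreover have "filtermap \<Phi> F \<noteq> bot"
    using assms by (simp add: filtermap_bot_iff)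
  ultimately obtain p where p: "inf (nhds p) (filtermap \<Phi> F) \<noteq> bot"
    unfolding compact_filter by blast
  define N where "N = inf F (filtercomap \<Phi> (nhds p))"
  have "N \<noteq> bot"
  proof
    assume "N = bot"
    then obtain P R where P: "eventually P F" and R: "eventually R (nhds p)"
      and PR: "\<And>k. P k \<Longrightarrow> R (\<Phi> k) \<Longrightarrow> False"
      by (fastforce simp: N_def trivial_limit_def eventually_inf eventually_filtercomap)
    have "eventually (\<lambda>q. \<not> R q) (filtermap \<Phi> F)"
      unfolding eventually_filtermap by (rule eventually_mono[OF P]) (use PR in blast)
    then have "eventually (\<lambda>_. False) (inf (nhds p) (filtermap \<Phi> F))"
      using R unfolding eventually_inf by blast
    then show False
      using p by (simp add: trivial_limit_def)
  qed
  moreover have "\<exists>l. (u \<longlongrightarrow> l) N" if "bounded (range u)" for u :: "'i \<Rightarrow> complex"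
  proof -
    have "filterlim \<Phi> (nhds p) N"
      unfolding N_def by (rule filterlim_mono[OF filterlim_filtercomap order_refl inf_le2])
    then have "((\<lambda>k. \<Phi> k u) \<longlongrightarrow> p u) N"
      by (rule continuous_on_tendsto_compose[OF continuous_on_product_coordinates]) auto
    then show ?thesis
      using that by (auto simp: \<Phi>_def)
  qed
  ultimately show thesis
    using that[of N] by (simp add: N_def)
qed

section \<open>A quadratic remainder estimate in one variable\<close>

text \<open>
  Cauchy's inequality on discs of radius \<open>R\<close> around the points of the unit disc bounds the second derivative there
  by \<open>2 M / R\<^sup>2\<close>; Taylor's formula turns this into a remainder that is quadratic in \<open>1 / R\<close>. With
  \<open>\<phi> \<zeta> = g (x + \<zeta> h)\<close> and \<open>R\<close> proportional to \<open>1 / \<parallel>h\<parallel>\<close> it becomes quadratic in \<open>h\<close>.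
\<close>
lemma Taylor_remainder_unit_disc:
  fixes \<phi> :: "complex \<Rightarrow> complex"
  assumes hol: "\<phi> holomorphic_on ball 0 S" and S: "2 * R < S" "1 \<le> R"
    and M: "\<And>\<zeta>. \<zeta> \<in> ball 0 S \<Longrightarrow> cmod (\<phi> \<zeta>) \<le> M"
  shows "cmod (\<phi> 1 - \<phi> 0 - deriv \<phi> 0) \<le> 2 * M / R\<^sup>2"
    and "cmod (deriv \<phi> 0) \<le> M / R"
proof -
  have bound: "cmod ((deriv ^^ n) \<phi> w) \<le> fact n * M / R ^ n" if "cmod w \<le> 1" for n w
  proof (rule Cauchy_inequality)
    have sub: "cball w R \<subseteq> ball 0 S"
    proof
      fix z assume "z \<in> cball w R"
      then have "cmod (z - w) \<le> R" by (simp add: dist_norm norm_minus_commute)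
      then show "z \<in> ball 0 S"
        using norm_triangle_sub[of z w] that S by simp
    qed
    show "\<phi> holomorphic_on ball w R"
      by (rule holomorphic_on_subset[OF hol]) (use sub in auto)
    show "continuous_on (cball w R) \<phi>"
      by (rule holomorphic_on_imp_continuous_on[OF holomorphic_on_subset[OF hol sub]])
    show "cmod (\<phi> x) \<le> M" if "cmod (w - x) = R" for x
      using that sub M[of x] by (auto simp: dist_norm subset_iff)
  qed (use S in auto)
  show "cmod (deriv \<phi> 0) \<le> M / R"
    using bound[of 0 1] by simp
  have "cmod ((deriv ^^ 0) \<phi> 1 - (\<Sum>i\<le>1. (deriv ^^ i) \<phi> 0 * (1 - 0) ^ i / fact i))
      \<le> 2 * M / R\<^sup>2 * cmod (1 - 0) ^ Suc 1 / fact 1"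
  proof (rule complex_Taylor[where f = "\<lambda>i. (deriv ^^ i) \<phi>" and S = "cball 0 1"])
    show "convex (cball (0::complex) 1)" by simp
    show "((deriv ^^ i) \<phi> has_field_derivative (deriv ^^ Suc i) \<phi> x) (at x within cball 0 1)"
      if "x \<in> cball 0 1" for i x
    proof -
      have "(deriv ^^ i) \<phi> holomorphic_on ball 0 S"
        by (intro holomorphic_higher_deriv hol) auto
      moreover have "x \<in> ball 0 S" using that S by auto
      ultimately show ?thesis
        by (auto intro: holomorphic_derivI DERIV_subset)
    qed
    show "cmod ((deriv ^^ Suc 1) \<phi> x) \<le> 2 * M / R\<^sup>2" if "x \<in> cball 0 1" for x
      using bound[of x 2] that by (simp add: numeral_2_eq_2)
  qed auto
  then show "cmod (\<phi> 1 - \<phi> 0 - deriv \<phi> 0) \<le> 2 * M / R\<^sup>2"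
    by (simp add: algebra_simps)
qed

section \<open>Normed spaces and their duals\<close>

locale normed_cspace =
  fixes X :: "('v::ab_group_add) cspace"
  assumes normed: "complex_normed_space X"
begin

lemma vector_space_smult: "vector_space (smult X)"
  using normed by (simp add: complex_normed_space_def)

sublocale vector_space "smult X"
  by (rule vector_space_smult)

lemma subspace_carrier: "subspace (carrier X)"
  using normed by (simp add: complex_normed_space_def)

lemmas zero_mem [simp] = subspace_0[OF subspace_carrier]
  and add_mem [simp] = subspace_add[OF subspace_carrier]
  and diff_mem [simp] = subspace_diff[OF subspace_carrier]
  and smult_mem [simp] = subspace_scale[OF subspace_carrier]
  and sum_mem = subspace_sum[OF subspace_carrier]

lemma nrm_nonneg [simp]: "x \<in> carrier X \<Longrightarrow> 0 \<le> nrm X x"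
  and nrm_eq_0_iff: "x \<in> carrier X \<Longrightarrow> nrm X x = 0 \<longleftrightarrow> x = 0"
  and nrm_add: "x \<in> carrier X \<Longrightarrow> y \<in> carrier X \<Longrightarrow> nrm X (x + y) \<le> nrm X x + nrm X y"
  and nrm_smult: "x \<in> carrier X \<Longrightarrow> nrm X (smult X c x) = cmod c * nrm X x"
  using normed by (auto simp: complex_normed_space_def)

lemma nrm_zero [simp]: "nrm X 0 = 0"
  by (simp add: nrm_eq_0_iff)

lemma nrm_minus: "x \<in> carrier X \<Longrightarrow> nrm X (- x) = nrm X x"
  using nrm_smult[of x "- 1"] by simp

lemma nrm_minus_commute: "x \<in> carrier X \<Longrightarrow> y \<in> carrier X \<Longrightarrow> nrm X (x - y) = nrm X (y - x)"
  using nrm_minus[of "x - y"] by simp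

lemma nrm_triangle_sub: "x \<in> carrier X \<Longrightarrow> y \<in> carrier X \<Longrightarrow> nrm X x \<le> nrm X y + nrm X (x - y)"
  using nrm_add[of y "x - y"] by simp

lemma nrm_triangle3:
  "x \<in> carrier X \<Longrightarrow> y \<in> carrier X \<Longrightarrow> z \<in> carrier X \<Longrightarrow> nrm X (x - z) \<le> nrm X (x - y) + nrm X (y - z)"
  using nrm_add[of "x - y" "y - z"] by simp

lemma nrm_sum: "finite I \<Longrightarrow> (\<And>i. i \<in> I \<Longrightarrow> f i \<in> carrier X) \<Longrightarrow> nrm X (sum f I) \<le> (\<Sum>i\<in>I. nrm X (f i))"
  by (induction I rule: finite_induct) (auto intro!: order_trans[OF nrm_add] sum_mem)

lemma Metric_space_ndist: "Metric_space (carrier X) (ndist X)"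
proof
  show "ndist X x z \<le> ndist X x y + ndist X y z"
    if "x \<in> carrier X" "y \<in> carrier X" "z \<in> carrier X" for x y z
    using that nrm_triangle3[of x y z] by (simp add: ndist_def)
qed (auto simp: ndist_def nrm_minus_commute nrm_eq_0_iff)

lemma in_unit_ball: "x \<in> unit_ball X \<longleftrightarrow> x \<in> carrier X \<and> nrm X x < 1"
  by (simp add: unit_ball_def)

lemma dual_iff:
  "\<phi> \<in> carrier (dual X) \<longleftrightarrow>
     (\<forall>x\<in>carrier X. \<forall>y\<in>carrier X. \<phi> (x + y) = \<phi> x + \<phi> y) \<and>
     (\<forall>c. \<forall>x\<in>carrier X. \<phi> (smult X c x) = c * \<phi> x) \<and>
     (\<exists>K. \<forall>x\<in>carrier X. cmod (\<phi> x) \<le> K * nrm X x) \<and>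
     (\<forall>x. x \<notin> carrier X \<longrightarrow> \<phi> x = 0)"
  by (simp add: dual_def)

lemma dual_add:
  "\<phi> \<in> carrier (dual X) \<Longrightarrow> x \<in> carrier X \<Longrightarrow> y \<in> carrier X \<Longrightarrow> \<phi> (x + y) = \<phi> x + \<phi> y"
  unfolding dual_iff by blast

lemma dual_smult:
  "\<phi> \<in> carrier (dual X) \<Longrightarrow> x \<in> carrier X \<Longrightarrow> \<phi> (smult X c x) = c * \<phi> x"
  unfolding dual_iff by blast

lemma dual_off: "\<phi> \<in> carrier (dual X) \<Longrightarrow> x \<notin> carrier X \<Longrightarrow> \<phi> x = 0"
  unfolding dual_iff by blast

lemma dual_diff:
  assumes "\<phi> \<in> carrier (dual X)" "x \<in> carrier X" "y \<in> carrier X"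
  shows "\<phi> (x - y) = \<phi> x - \<phi> y"
proof -
  have "\<phi> (x - y + y) = \<phi> (x - y) + \<phi> y"
    by (intro dual_add diff_mem assms)
  then show ?thesis by simp
qed

text \<open>
  The dual norm is a supremum of reals, about which nothing can be said unless the set is bounded.
\<close>
lemma dual_bdd_above:
  assumes "\<phi> \<in> carrier (dual X)"
  shows "bdd_above ((\<lambda>x. cmod (\<phi> x)) ` closed_unit_ball X)"
proof -
  obtain K where K: "\<And>x. x \<in> carrier X \<Longrightarrow> cmod (\<phi> x) \<le> K * nrm X x"
    using assms unfolding dual_iff by blast
  have "cmod (\<phi> x) \<le> \<bar>K\<bar>" if "x \<in> closed_unit_ball X" for x
  proof -
    have "x \<in> carrier X" "nrm X x \<le> 1"
      using that by (auto simp: closed_unit_ball_def)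
    then have "K * nrm X x \<le> \<bar>K\<bar> * 1"
      by (intro mult_mono) auto
    then show ?thesis
      using K[OF \<open>x \<in> carrier X\<close>] by simp
  qed
  then show ?thesis
    by (auto simp: bdd_above_def)
qed

lemma nrm_dual: "nrm (dual X) \<phi> = (SUP x\<in>closed_unit_ball X. cmod (\<phi> x))"
  by (simp add: dual_def)

lemma closed_unit_ball_nonempty: "closed_unit_ball X \<noteq> {}"
proof -
  have "0 \<in> closed_unit_ball X" by (simp add: closed_unit_ball_def)
  then show ?thesis by blast
qed

lemma nrm_dual_le:
  assumes "\<And>x. x \<in> closed_unit_ball X \<Longrightarrow> cmod (\<phi> x) \<le> B"
  shows "nrm (dual X) \<phi> \<le> B"
  unfolding nrm_dual by (rule cSUP_least[OF closed_unit_ball_nonempty assms])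

lemma norm_apply_le_nrm_dual:
  assumes \<phi>: "\<phi> \<in> carrier (dual X)" and x: "x \<in> carrier X"
  shows "cmod (\<phi> x) \<le> nrm (dual X) \<phi> * nrm X x"
proof (cases "x = 0")
  case True
  then show ?thesis using dual_diff[OF \<phi> x x] by simp
next
  case False
  define n where "n = nrm X x"
  have n: "n > 0"
    using nrm_nonneg[OF x] nrm_eq_0_iff[OF x] False by (simp add: n_def)
  define u where "u = smult X (inverse (of_real n)) x"
  have "u \<in> closed_unit_ball X"
    using x n by (simp add: u_def closed_unit_ball_def nrm_smult norm_inverse flip: n_def)
  then have "cmod (\<phi> u) \<le> nrm (dual X) \<phi>"
    unfolding nrm_dual by (rule cSUP_upper[OF _ dual_bdd_above[OF \<phi>]])
  moreover have "\<phi> u = inverse (of_real n) * \<phi> x"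
    unfolding u_def by (rule dual_smult[OF \<phi> x])
  ultimately show ?thesis
    using n by (simp add: norm_mult norm_inverse norm_divide field_simps flip: n_def)
qed

lemma normed_cspace_dual: "normed_cspace (dual X)"
proof
  have mem: "(\<lambda>x. c * \<phi> x) \<in> carrier (dual X)" if \<phi>: "\<phi> \<in> carrier (dual X)" for c \<phi>
  proof -
    obtain K where K: "\<And>x. x \<in> carrier X \<Longrightarrow> cmod (\<phi> x) \<le> K * nrm X x"
      using \<phi> unfolding dual_iff by blast
    have "cmod (c * \<phi> x) \<le> cmod c * K * nrm X x" if "x \<in> carrier X" for x
      using mult_left_mono[OF K[OF that], of "cmod c"] by (simp add: norm_mult mult.assoc)
    then have "\<exists>K. \<forall>x\<in>carrier X. cmod (c * \<phi> x) \<le> K * nrm X x" by blast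
    then show ?thesis
      using \<phi> unfolding dual_iff by (simp add: algebra_simps)
  qed
  have add: "\<phi> + \<psi> \<in> carrier (dual X)" if \<phi>: "\<phi> \<in> carrier (dual X)" and \<psi>: "\<psi> \<in> carrier (dual X)" for \<phi> \<psi>
  proof -
    obtain K where K: "\<And>x. x \<in> carrier X \<Longrightarrow> cmod (\<phi> x) \<le> K * nrm X x"
      using \<phi> unfolding dual_iff by blast
    obtain L where L: "\<And>x. x \<in> carrier X \<Longrightarrow> cmod (\<psi> x) \<le> L * nrm X x"
      using \<psi> unfolding dual_iff by blast
    have "cmod ((\<phi> + \<psi>) x) \<le> (K + L) * nrm X x" if "x \<in> carrier X" for x
      using norm_triangle_ineq[of "\<phi> x" "\<psi> x"] K[OF that] L[OF that] by (simp add: algebra_simps)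
    then have "\<exists>K. \<forall>x\<in>carrier X. cmod ((\<phi> + \<psi>) x) \<le> K * nrm X x" by blast
    then show ?thesis
      using \<phi> \<psi> unfolding dual_iff by (simp add: algebra_simps)
  qed
  have sm: "smult (dual X) c \<phi> = (\<lambda>x. c * \<phi> x)" for c \<phi>
    by (simp add: dual_def)
  have vs: "vector_space (smult (dual X))"
    by unfold_locales (auto simp: sm fun_eq_iff algebra_simps)
  interpret D: vector_space "smult (dual X)" by (rule vs)
  have zero: "0 \<in> carrier (dual X)"
    by (auto simp: dual_iff intro!: exI[of _ 0])
  have nn: "0 \<le> nrm (dual X) \<phi>" if "\<phi> \<in> carrier (dual X)" for \<phi>
  proof -
    have "0 \<in> closed_unit_ball X" by (simp add: closed_unit_ball_def)
    then have "cmod (\<phi> 0) \<le> nrm (dual X) \<phi>"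
      unfolding nrm_dual by (rule cSUP_upper[OF _ dual_bdd_above[OF that]])
    then show ?thesis
      using norm_ge_zero order_trans by blast
  qed
  have sc: "nrm (dual X) (smult (dual X) c \<phi>) \<le> cmod c * nrm (dual X) \<phi>" if "\<phi> \<in> carrier (dual X)" for c \<phi>
  proof (rule nrm_dual_le)
    fix x assume "x \<in> closed_unit_ball X"
    then have "cmod (\<phi> x) \<le> nrm (dual X) \<phi>"
      unfolding nrm_dual by (rule cSUP_upper[OF _ dual_bdd_above[OF that]])
    then show "cmod (smult (dual X) c \<phi> x) \<le> cmod c * nrm (dual X) \<phi>"
      by (simp add: sm norm_mult mult_left_mono)
  qed
  show "complex_normed_space (dual X)"
    unfolding complex_normed_space_def
  proof (intro conjI ballI allI)
    show "D.subspace (carrier (dual X))"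
      by (rule D.subspaceI) (use zero add mem in \<open>simp_all add: sm\<close>)
  next
    fix \<phi> assume \<phi>: "\<phi> \<in> carrier (dual X)"
    show "nrm (dual X) \<phi> = 0 \<longleftrightarrow> \<phi> = 0"
    proof
      assume 0: "nrm (dual X) \<phi> = 0"
      have "\<phi> x = 0" for x
        using norm_apply_le_nrm_dual[OF \<phi>, of x] dual_off[OF \<phi>, of x] 0 by (cases "x \<in> carrier X") auto
      then show "\<phi> = 0" by (simp add: fun_eq_iff)
    next
      assume "\<phi> = 0"
      then have "nrm (dual X) \<phi> \<le> 0" by (intro nrm_dual_le) simp
      then show "nrm (dual X) \<phi> = 0" using nn[OF \<phi>] by simp
    qed
  next
    fix \<phi> \<psi> assume \<phi>: "\<phi> \<in> carrier (dual X)" and \<psi>: "\<psi> \<in> carrier (dual X)"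
    show "nrm (dual X) (\<phi> + \<psi>) \<le> nrm (dual X) \<phi> + nrm (dual X) \<psi>"
    proof (rule nrm_dual_le)
      fix x assume "x \<in> closed_unit_ball X"
      then have "cmod (\<phi> x) \<le> nrm (dual X) \<phi>" "cmod (\<psi> x) \<le> nrm (dual X) \<psi>"
        unfolding nrm_dual using \<phi> \<psi> by (auto intro!: cSUP_upper dual_bdd_above)
      then show "cmod ((\<phi> + \<psi>) x) \<le> nrm (dual X) \<phi> + nrm (dual X) \<psi>"
        using norm_triangle_ineq[of "\<phi> x" "\<psi> x"] by simp
    qed
  next
    fix c \<phi> assume \<phi>: "\<phi> \<in> carrier (dual X)"
    show "nrm (dual X) (smult (dual X) c \<phi>) = cmod c * nrm (dual X) \<phi>"
    proof (cases "c = 0")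
      case True
      have "nrm (dual X) (smult (dual X) c \<phi>) \<ge> 0"
        using mem[OF \<phi>, of c] by (intro nn) (simp add: sm)
      then show ?thesis using sc[OF \<phi>, of c] True by simp
    next
      case False
      have "smult (dual X) c \<phi> \<in> carrier (dual X)"
        using mem[OF \<phi>, of c] by (simp add: sm)
      from sc[OF this, of "inverse c"] have "nrm (dual X) \<phi> \<le> inverse (cmod c) * nrm (dual X) (smult (dual X) c \<phi>)"
        using False by (simp add: sm norm_inverse mult.assoc[symmetric])
      then have "cmod c * nrm (dual X) \<phi> \<le> nrm (dual X) (smult (dual X) c \<phi>)"
        using False by (simp add: field_simps)
      then show ?thesis using sc[OF \<phi>, of c] by simp
    qed
  qed (rule vs, erule nn)
qed

section \<open>Cauchy estimates on the unit ball\<close>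

lemma Hinf_bounded:
  assumes "g \<in> Hinf_algebra X"
  shows "\<exists>M\<ge>0. \<forall>x. cmod (g x) \<le> M"
proof -
  obtain M where "\<forall>x\<in>unit_ball X. cmod (g x) \<le> M"
    using assms by (auto simp: Hinf_algebra_def bounded_iff)
  then have "cmod (g x) \<le> max M 0" for x
    using assms by (cases "x \<in> unit_ball X") (auto simp: Hinf_algebra_def le_max_iff_disj)
  then show ?thesis by (intro exI[of _ "max M 0"]) simp
qed

definition frechet_deriv :: "('v \<Rightarrow> complex) \<Rightarrow> 'v \<Rightarrow> 'v \<Rightarrow> complex" where
  "frechet_deriv g x = (SOME D. D \<in> carrier (dual X) \<and>
     (\<forall>e>0. \<exists>d>0. \<forall>y\<in>unit_ball X.
        ndist X y x < d \<longrightarrow> cmod (g y - g x - D (y - x)) \<le> e * ndist X y x))"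

lemma frechet_deriv:
  assumes "g \<in> Hinf_algebra X" "x \<in> unit_ball X"
  shows "frechet_deriv g x \<in> carrier (dual X)"
    and "e > 0 \<Longrightarrow> \<exists>d>0. \<forall>y\<in>unit_ball X.
      ndist X y x < d \<longrightarrow> cmod (g y - g x - frechet_deriv g x (y - x)) \<le> e * ndist X y x"
proof -
  have "\<exists>D. D \<in> carrier (dual X) \<and> (\<forall>e>0. \<exists>d>0. \<forall>y\<in>unit_ball X.
        ndist X y x < d \<longrightarrow> cmod (g y - g x - D (y - x)) \<le> e * ndist X y x)"
    using assms by (auto simp: Hinf_algebra_def analytic_on_ball_def)
  from someI_ex[OF this] show "frechet_deriv g x \<in> carrier (dual X)"
    and "e > 0 \<Longrightarrow> \<exists>d>0. \<forall>y\<in>unit_ball X.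
      ndist X y x < d \<longrightarrow> cmod (g y - g x - frechet_deriv g x (y - x)) \<le> e * ndist X y x"
    by (auto simp: frechet_deriv_def)
qed

lemma has_field_derivative_on_line:
  assumes g: "g \<in> Hinf_algebra X" and x: "x \<in> carrier X" and h: "h \<in> carrier X"
    and mem: "x + smult X \<zeta> h \<in> unit_ball X"
  shows "((\<lambda>\<zeta>. g (x + smult X \<zeta> h)) has_field_derivative frechet_deriv g (x + smult X \<zeta> h) h) (at \<zeta>)"
proof -
  define p where "p = x + smult X \<zeta> h"
  define D where "D = frechet_deriv g p"
  have p: "p \<in> carrier X" "nrm X p < 1"
    using mem by (auto simp: in_unit_ball p_def)
  have D: "D \<in> carrier (dual X)"
    using frechet_deriv(1)[OF g] mem by (simp add: D_def p_def)
  have diff: "x + smult X w h - p = smult X (w - \<zeta>) h" for w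
    by (simp add: p_def scale_left_diff_distrib)
  have carr: "x + smult X w h \<in> carrier X" for w
    using x h by simp
  have nd: "ndist X (x + smult X w h) p = cmod (w - \<zeta>) * nrm X h" for w
    using carr p h by (simp add: ndist_def diff nrm_smult)
  have Dd: "D (smult X c h) = c * D h" for c
    by (rule dual_smult[OF D h])
  have "((\<lambda>\<zeta>. g (x + smult X \<zeta> h)) has_derivative (\<lambda>w. D h * w)) (at \<zeta>)"
    unfolding has_derivative_at_alt
  proof (intro conjI allI impI)
    show "bounded_linear ((*) (D h))" by (rule bounded_linear_mult_right)
    fix e :: real assume e: "e > 0"
    \<comment> \<open>The added 1 covers the case \<open>h = 0\<close>.\<close>
    define e' where "e' = e / (nrm X h + 1)"
    have e': "e' > 0" "e' * nrm X h \<le> e"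
      using e nrm_nonneg[OF h] by (auto simp: e'_def pos_divide_le_eq add_nonneg_pos mult_left_mono)
    obtain d where d: "d > 0" and dd: "\<And>y. y \<in> unit_ball X \<Longrightarrow>
      ndist X y p < d \<Longrightarrow> cmod (g y - g p - D (y - p)) \<le> e' * ndist X y p"
      using frechet_deriv(2)[OF g, of p e'] mem e' by (auto simp: p_def D_def)
    define \<delta> where "\<delta> = min d (1 - nrm X p) / (nrm X h + 1)"
    have \<delta>: "\<delta> > 0"
      using d p nrm_nonneg[OF h] by (simp add: \<delta>_def)
    show "\<exists>d>0. \<forall>y. cmod (y - \<zeta>) < d \<longrightarrow>
          cmod (g (x + smult X y h) - g (x + smult X \<zeta> h) - D h * (y - \<zeta>)) \<le> e * cmod (y - \<zeta>)"
    proof (intro exI[of _ \<delta>] conjI allI impI \<delta>)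
      fix w assume w: "cmod (w - \<zeta>) < \<delta>"
      have "cmod (w - \<zeta>) * nrm X h \<le> cmod (w - \<zeta>) * (nrm X h + 1)"
        using nrm_nonneg[OF h] by (intro mult_left_mono) auto
      also have "\<dots> < min d (1 - nrm X p)"
        using w nrm_nonneg[OF h] by (simp add: \<delta>_def pos_less_divide_eq)
      finally have less: "cmod (w - \<zeta>) * nrm X h < d" "cmod (w - \<zeta>) * nrm X h < 1 - nrm X p"
        by auto
      have "nrm X (x + smult X w h) \<le> nrm X p + cmod (w - \<zeta>) * nrm X h"
        using nrm_triangle_sub[OF carr p(1), of w] h by (simp add: diff nrm_smult)
      then have "x + smult X w h \<in> unit_ball X"
        using less carr by (simp add: in_unit_ball)
      from dd[OF this] have "cmod (g (x + smult X w h) - g p - (w - \<zeta>) * D h) \<le> e' * (cmod (w - \<zeta>) * nrm X h)"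
        using less by (simp add: nd diff Dd)
      also have "\<dots> \<le> e * cmod (w - \<zeta>)"
        using mult_right_mono[OF e'(2), of "cmod (w - \<zeta>)"] by (simp add: mult_ac)
      finally show "cmod (g (x + smult X w h) - g (x + smult X \<zeta> h) - D h * (w - \<zeta>)) \<le> e * cmod (w - \<zeta>)"
        by (simp add: p_def mult.commute)
    qed
  qed
  then show ?thesis
    by (simp add: has_field_derivative_def D_def p_def)
qed

text \<open>
  The constants do not depend on \<open>x\<close> as long as \<open>x\<close> keeps distance \<open>3 r\<close> from the unit sphere. This uniformity is what
  allows passing to limits along nets of points. Two of the three \<open>r\<close> are used by the closed discs of radius \<open>r\<close> around the
  points \<open>x + \<zeta> h\<close> with \<open>|\<zeta>| \<le> 1\<close>; the third puts these discs inside an open disc on which \<open>g\<close> is analytic.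
\<close>
lemma frechet_deriv_estimates:
  assumes g: "g \<in> Hinf_algebra X" and M: "M \<ge> 0" "\<And>x. cmod (g x) \<le> M"
    and x: "x \<in> carrier X" and r: "r > 0" "nrm X x + 3 * r \<le> 1"
    and h: "h \<in> carrier X" "nrm X h \<le> r"
  shows "cmod (g (x + h) - g x - frechet_deriv g x h) \<le> 2 * M / r\<^sup>2 * (nrm X h)\<^sup>2"
    and "cmod (frechet_deriv g x h) \<le> M / r * nrm X h"
proof -
  have xb: "x \<in> unit_ball X"
    using x r by (simp add: in_unit_ball)
  note D = frechet_deriv(1)[OF g xb]
  have "cmod (g (x + h) - g x - frechet_deriv g x h) \<le> 2 * M / r\<^sup>2 * (nrm X h)\<^sup>2
    \<and> cmod (frechet_deriv g x h) \<le> M / r * nrm X h"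
  proof (cases "h = 0")
    case True
    then show ?thesis using dual_diff[OF D zero_mem zero_mem] by simp
  next
    case False
    define n where "n = nrm X h"
    have n: "n > 0" "n \<le> r"
      using nrm_nonneg[OF h(1)] nrm_eq_0_iff[OF h(1)] False h unfolding n_def by linarith+
    define \<phi> where "\<phi> = (\<lambda>\<zeta>. g (x + smult X \<zeta> h))"
    have der: "(\<phi> has_field_derivative frechet_deriv g (x + smult X \<zeta> h) h) (at \<zeta>)"
      if "cmod \<zeta> < 3 * (r / n)" for \<zeta>
    proof -
      have "cmod \<zeta> * n < 3 * r"
        using that n by (simp add: field_simps)
      then have "nrm X (x + smult X \<zeta> h) < 1"
        using nrm_add[of x "smult X \<zeta> h"] x h r by (simp add: nrm_smult n_def)
      then have "x + smult X \<zeta> h \<in> unit_ball X"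
        using x h by (simp add: in_unit_ball)
      then show ?thesis
        unfolding \<phi>_def by (rule has_field_derivative_on_line[OF g x h(1)])
    qed
    have hol: "\<phi> holomorphic_on ball 0 (3 * (r / n))"
      by (rule holomorphic_onI, rule field_differentiable_at_within)
        (use der in \<open>auto simp: field_differentiable_def\<close>)
    have d0: "deriv \<phi> 0 = frechet_deriv g x h"
      by (rule DERIV_imp_deriv) (use der[of 0] n r in simp)
    \<comment> \<open>The discs of radius \<open>r / n\<close> in \<open>\<zeta>\<close> correspond to displacements of norm \<open>r\<close> in the space.\<close>
    have "2 * (r / n) < 3 * (r / n)" "1 \<le> r / n"
      using n r by (auto simp: field_simps)
    from Taylor_remainder_unit_disc[OF hol this, of M] M
    have "cmod (\<phi> 1 - \<phi> 0 - deriv \<phi> 0) \<le> 2 * M / (r / n)\<^sup>2" "cmod (deriv \<phi> 0) \<le> M / (r / n)"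
      by (auto simp: \<phi>_def)
    moreover have "\<phi> 1 = g (x + h)" "\<phi> 0 = g x"
      by (simp_all add: \<phi>_def)
    ultimately show ?thesis
      by (simp add: d0 power_divide flip: n_def)
  qed
  then show "cmod (g (x + h) - g x - frechet_deriv g x h) \<le> 2 * M / r\<^sup>2 * (nrm X h)\<^sup>2"
    and "cmod (frechet_deriv g x h) \<le> M / r * nrm X h" by auto
qed

lemma frechet_deriv_bound:
  assumes g: "g \<in> Hinf_algebra X" and M: "M \<ge> 0" "\<And>x. cmod (g x) \<le> M"
    and x: "x \<in> carrier X" and r: "r > 0" "nrm X x + 3 * r \<le> 1"
    and h: "h \<in> carrier X"
  shows "cmod (frechet_deriv g x h) \<le> M / r * nrm X h"
proof -
  have D: "frechet_deriv g x \<in> carrier (dual X)"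
    by (rule frechet_deriv(1)[OF g]) (use x r in \<open>simp add: in_unit_ball\<close>)
  \<comment> \<open>Rescaled by \<open>c\<close> the vector has norm at most \<open>r\<close>; linearity removes the restriction on \<open>h\<close>.\<close>
  define c where "c = r / (r + nrm X h)"
  have c: "c > 0" "c * nrm X h \<le> r"
    using r nrm_nonneg[OF h] by (auto simp: c_def field_simps add_pos_nonneg)
  have "frechet_deriv g x (smult X (of_real c) h) = of_real c * frechet_deriv g x h"
    by (rule dual_smult[OF D h])
  moreover have "cmod (frechet_deriv g x (smult X (of_real c) h)) \<le> M / r * nrm X (smult X (of_real c) h)"
    by (rule frechet_deriv_estimates(2)[OF g M x r]) (use h c in \<open>auto simp: nrm_smult\<close>)
  ultimately have "c * cmod (frechet_deriv g x h) \<le> c * (M / r * nrm X h)"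
    using c h by (simp add: norm_mult nrm_smult mult_ac)
  then show ?thesis using c(1) by (rule mult_left_le_imp_le)
qed

lemma Hinf_locally_Lipschitz:
  assumes g: "g \<in> Hinf_algebra X" and M: "M \<ge> 0" "\<And>x. cmod (g x) \<le> M"
    and x: "x \<in> carrier X" and r: "r > 0" "nrm X x + 3 * r \<le> 1"
    and h: "y \<in> carrier X" "nrm X (y - x) \<le> r"
  shows "cmod (g y - g x) \<le> 3 * M / r * nrm X (y - x)"
proof -
  define n where "n = nrm X (y - x)"
  have n: "0 \<le> n" "n \<le> r"
    using h x by (auto simp: n_def)
  have yx: "y - x \<in> carrier X" using h x by simp
  have "cmod (g y - g x - frechet_deriv g x (y - x)) \<le> 2 * M / r\<^sup>2 * n\<^sup>2"
    using frechet_deriv_estimates(1)[OF g M x r yx] h by (simp add: n_def)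
  moreover have "cmod (frechet_deriv g x (y - x)) \<le> M / r * n"
    using frechet_deriv_bound[OF g M x r yx] by (simp add: n_def)
  moreover have "2 * M / r\<^sup>2 * n\<^sup>2 \<le> 2 * M / r * n"
  proof -
    have "2 * M / r\<^sup>2 * n * n \<le> 2 * M / r\<^sup>2 * n * r"
      using n M by (intro mult_left_mono) auto
    then show ?thesis
      using r by (simp add: power2_eq_square)
  qed
  ultimately show ?thesis
    using norm_triangle_ineq[of "g y - g x - frechet_deriv g x (y - x)" "frechet_deriv g x (y - x)"]
    by (simp add: n_def[symmetric])
qed

end

section \<open>Transfer along an asymptotic retraction\<close>

text \<open>
  The maps \<open>J k\<close> are in general neither linear nor isometric; they are so in the limit along \<open>N\<close>. The data amount to a
  linear isometric embedding of \<open>Y\<close> into an ultrapower of \<open>X\<close> on which the ultrapower of \<open>Q\<close> is a left inverse, stated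
  without forming the ultrapower.
\<close>
locale asymptotic_retraction =
  X: normed_cspace X + Y: normed_cspace Y
  for X :: "('x::ab_group_add) cspace" and Y :: "('y::ab_group_add) cspace" +
  fixes N :: "'i filter" and J :: "'i \<Rightarrow> 'y \<Rightarrow> 'x" and Q :: "'x \<Rightarrow> 'y"
  assumes nontrivial: "N \<noteq> bot"
    and bounded_convergent: "\<And>u :: 'i \<Rightarrow> complex. bounded (range u) \<Longrightarrow> \<exists>l. (u \<longlongrightarrow> l) N"
    and J_mem: "\<And>y. y \<in> carrier Y \<Longrightarrow> eventually (\<lambda>k. J k y \<in> carrier X) N"
    and J_nrm: "\<And>y. y \<in> carrier Y \<Longrightarrow> ((\<lambda>k. nrm X (J k y)) \<longlongrightarrow> nrm Y y) N"
    and J_add: "\<And>y z. y \<in> carrier Y \<Longrightarrow> z \<in> carrier Y \<Longrightarrow>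
      ((\<lambda>k. nrm X (J k (y + z) - J k y - J k z)) \<longlongrightarrow> 0) N"
    and J_smult: "\<And>c y. y \<in> carrier Y \<Longrightarrow>
      ((\<lambda>k. nrm X (J k (smult Y c y) - smult X c (J k y))) \<longlongrightarrow> 0) N"
    and Q_mem: "\<And>x. x \<in> carrier X \<Longrightarrow> Q x \<in> carrier Y"
    and Q_add: "\<And>x z. x \<in> carrier X \<Longrightarrow> z \<in> carrier X \<Longrightarrow> Q (x + z) = Q x + Q z"
    and Q_smult: "\<And>c x. x \<in> carrier X \<Longrightarrow> Q (smult X c x) = smult Y c (Q x)"
    and Q_nrm: "\<And>x. x \<in> carrier X \<Longrightarrow> nrm Y (Q x) \<le> nrm X x"
    and Q_J: "\<And>y. y \<in> carrier Y \<Longrightarrow> ((\<lambda>k. nrm Y (Q (J k y) - y)) \<longlongrightarrow> 0) N"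
begin

lemma tendsto_LimN:
  assumes "eventually (\<lambda>k. cmod (u k) \<le> B) N"
  shows "(u \<longlongrightarrow> Lim N u) N"
proof -
  define v where "v k = (if cmod (u k) \<le> B then u k else 0)" for k
  have "cmod (v k) \<le> \<bar>B\<bar>" for k
    by (auto simp: v_def)
  then have "bounded (range v)"
    by (auto simp: bounded_iff)
  then obtain l where "(v \<longlongrightarrow> l) N"
    using bounded_convergent by blast
  moreover have "eventually (\<lambda>k. v k = u k) N"
    using assms by eventually_elim (simp add: v_def)
  ultimately have "(u \<longlongrightarrow> l) N"
    by (rule Lim_transform_eventually)
  then show ?thesis
    by (simp add: tendsto_Lim[OF nontrivial])
qed

lemma J_diff:
  assumes y: "y \<in> carrier Y" and z: "z \<in> carrier Y"
  shows "((\<lambda>k. nrm X (J k y - J k z - J k (y - z))) \<longlongrightarrow> 0) N"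
    and "((\<lambda>k. nrm X (J k y - J k z)) \<longlongrightarrow> nrm Y (y - z)) N"
proof -
  have w: "y - z \<in> carrier Y" using y z by simp
  show 0: "((\<lambda>k. nrm X (J k y - J k z - J k (y - z))) \<longlongrightarrow> 0) N"
    using J_add[OF z w] by simp
  have "eventually (\<lambda>k. norm (nrm X (J k y - J k z) - nrm X (J k (y - z)))
      \<le> nrm X (J k y - J k z - J k (y - z))) N"
    using J_mem[OF y] J_mem[OF z] J_mem[OF w]
  proof eventually_elim
    case (elim k)
    then show ?case
      using X.nrm_triangle_sub[of "J k y - J k z" "J k (y - z)"]
        X.nrm_triangle_sub[of "J k (y - z)" "J k y - J k z"]
        X.nrm_minus_commute[of "J k y - J k z" "J k (y - z)"] by simp
  qed
  then have "((\<lambda>k. nrm X (J k y - J k z) - nrm X (J k (y - z))) \<longlongrightarrow> 0) N"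
    by (rule Lim_null_comparison[OF _ 0])
  from tendsto_add[OF this J_nrm[OF w]]
  show "((\<lambda>k. nrm X (J k y - J k z)) \<longlongrightarrow> nrm Y (y - z)) N" by simp
qed

lemma J_ball:
  assumes "y \<in> unit_ball Y"
  shows "eventually (\<lambda>k. J k y \<in> unit_ball X) N"
proof -
  have y: "y \<in> carrier Y" "nrm Y y < 1"
    using assms by (auto simp: Y.in_unit_ball)
  show ?thesis
    using J_mem[OF y(1)] order_tendstoD(2)[OF J_nrm[OF y(1)] y(2)]
    by eventually_elim (simp add: X.in_unit_ball)
qed

text \<open>
  The functional may vary with the index: the constant net gives the map \<open>X\<^sup>* \<rightarrow> Y\<^sup>*\<close>, and the derivatives of \<open>g\<close> at
  the points \<open>J k y\<close> give the derivative of the limit function at \<open>y\<close>.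
\<close>
definition limit_functional :: "('i \<Rightarrow> 'x \<Rightarrow> complex) \<Rightarrow> 'y \<Rightarrow> complex" where
  "limit_functional \<psi> y = (if y \<in> carrier Y then Lim N (\<lambda>k. \<psi> k (J k y)) else 0)"

context
  fixes \<psi> :: "'i \<Rightarrow> 'x \<Rightarrow> complex" and L :: real
  assumes \<psi>: "eventually (\<lambda>k. \<psi> k \<in> carrier (dual X)) N"
    and L: "L \<ge> 0" "eventually (\<lambda>k. \<forall>x\<in>carrier X. cmod (\<psi> k x) \<le> L * nrm X x) N"
begin

text \<open>
  Uniform boundedness of the net of functionals is what removes the error terms caused by the nonlinearity of \<open>J k\<close>.
\<close>
lemma functional_null:
  assumes "eventually (\<lambda>k. u k \<in> carrier X) N" "((\<lambda>k. nrm X (u k)) \<longlongrightarrow> 0) N"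
  shows "((\<lambda>k. \<psi> k (u k)) \<longlongrightarrow> 0) N"
proof (rule Lim_null_comparison)
  show "eventually (\<lambda>k. cmod (\<psi> k (u k)) \<le> L * nrm X (u k)) N"
    using assms(1) L(2) by eventually_elim auto
  show "((\<lambda>k. L * nrm X (u k)) \<longlongrightarrow> 0) N"
    by (rule tendsto_mult_right_zero[OF assms(2)])
qed

lemma tendsto_limit_functional:
  assumes y: "y \<in> carrier Y"
  shows "((\<lambda>k. \<psi> k (J k y)) \<longlongrightarrow> limit_functional \<psi> y) N"
proof -
  have "eventually (\<lambda>k. nrm X (J k y) < nrm Y y + 1) N"
    by (rule order_tendstoD(2)[OF J_nrm[OF y]]) simp
  with J_mem[OF y] L(2) have "eventually (\<lambda>k. cmod (\<psi> k (J k y)) \<le> L * (nrm Y y + 1)) N"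
  proof eventually_elim
    case (elim k)
    then have "cmod (\<psi> k (J k y)) \<le> L * nrm X (J k y)" by blast
    also have "\<dots> \<le> L * (nrm Y y + 1)"
      using elim L(1) by (intro mult_left_mono) auto
    finally show ?case .
  qed
  from tendsto_LimN[OF this] y show ?thesis
    by (simp add: limit_functional_def)
qed

lemma limit_functional_bound:
  assumes y: "y \<in> carrier Y"
  shows "cmod (limit_functional \<psi> y) \<le> L * nrm Y y"
proof (rule tendsto_le[OF nontrivial])
  show "((\<lambda>k. cmod (\<psi> k (J k y))) \<longlongrightarrow> cmod (limit_functional \<psi> y)) N"
    by (intro tendsto_norm tendsto_limit_functional y)
  show "((\<lambda>k. L * nrm X (J k y)) \<longlongrightarrow> L * nrm Y y) N"
    by (intro tendsto_mult_left J_nrm y)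
  show "eventually (\<lambda>k. cmod (\<psi> k (J k y)) \<le> L * nrm X (J k y)) N"
    using J_mem[OF y] L(2) by eventually_elim auto
qed

lemma limit_functional_mem: "limit_functional \<psi> \<in> carrier (dual Y)"
  unfolding Y.dual_iff
proof (intro conjI ballI allI impI)
  fix y z assume y: "y \<in> carrier Y" and z: "z \<in> carrier Y"
  then have yz: "y + z \<in> carrier Y" by simp
  have "((\<lambda>k. \<psi> k (J k (y + z) - J k y - J k z)) \<longlongrightarrow> 0) N"
    by (rule functional_null[OF _ J_add[OF y z]])
      (use J_mem[OF y] J_mem[OF z] J_mem[OF yz] in \<open>eventually_elim, simp\<close>)
  moreover have "eventually (\<lambda>k. \<psi> k (J k (y + z) - J k y - J k z)
      = \<psi> k (J k (y + z)) - \<psi> k (J k y) - \<psi> k (J k z)) N"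
    using J_mem[OF y] J_mem[OF z] J_mem[OF yz] \<psi>
  proof eventually_elim
    case (elim k)
    note d = X.dual_diff[OF elim(4)]
    show ?case
      using d[OF X.diff_mem[OF elim(3,1)] elim(2)] d[OF elim(3,1)] by (simp only:)
  qed
  ultimately have "((\<lambda>k. \<psi> k (J k (y + z)) - \<psi> k (J k y) - \<psi> k (J k z)) \<longlongrightarrow> 0) N"
    by (rule Lim_transform_eventually)
  moreover have "((\<lambda>k. \<psi> k (J k (y + z)) - \<psi> k (J k y) - \<psi> k (J k z)) \<longlongrightarrow>
      limit_functional \<psi> (y + z) - limit_functional \<psi> y - limit_functional \<psi> z) N"
    by (intro tendsto_diff tendsto_limit_functional y z yz)
  ultimately have "limit_functional \<psi> (y + z) - limit_functional \<psi> y - limit_functional \<psi> z = 0"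
    by (rule tendsto_unique[OF nontrivial, rotated])
  then show "limit_functional \<psi> (y + z) = limit_functional \<psi> y + limit_functional \<psi> z"
    by (simp add: algebra_simps)
next
  fix c y assume y: "y \<in> carrier Y"
  then have cy: "smult Y c y \<in> carrier Y" by simp
  have "((\<lambda>k. \<psi> k (J k (smult Y c y) - smult X c (J k y))) \<longlongrightarrow> 0) N"
    by (rule functional_null[OF _ J_smult[OF y]])
      (use J_mem[OF y] J_mem[OF cy] in \<open>eventually_elim, simp\<close>)
  moreover have "eventually (\<lambda>k. \<psi> k (J k (smult Y c y) - smult X c (J k y))
      = \<psi> k (J k (smult Y c y)) - c * \<psi> k (J k y)) N"
    using J_mem[OF y] J_mem[OF cy] \<psi>
  proof eventually_elim
    case (elim k)
    then have "\<psi> k (smult X c (J k y)) = c * \<psi> k (J k y)"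
      by (intro X.dual_smult)
    then show ?case
      using X.dual_diff[OF elim(3) elim(2) X.smult_mem[OF elim(1)], of c] by (simp only:)
  qed
  ultimately have "((\<lambda>k. \<psi> k (J k (smult Y c y)) - c * \<psi> k (J k y)) \<longlongrightarrow> 0) N"
    by (rule Lim_transform_eventually)
  moreover have "((\<lambda>k. \<psi> k (J k (smult Y c y)) - c * \<psi> k (J k y)) \<longlongrightarrow>
      limit_functional \<psi> (smult Y c y) - c * limit_functional \<psi> y) N"
    by (intro tendsto_diff tendsto_mult_left tendsto_limit_functional y cy)
  ultimately have "limit_functional \<psi> (smult Y c y) - c * limit_functional \<psi> y = 0"
    by (rule tendsto_unique[OF nontrivial, rotated])
  then show "limit_functional \<psi> (smult Y c y) = c * limit_functional \<psi> y" by simp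
next
  show "\<exists>K. \<forall>x\<in>carrier Y. cmod (limit_functional \<psi> x) \<le> K * nrm Y x"
    by (intro exI[of _ L] ballI limit_functional_bound)
qed (simp add: limit_functional_def)

end

text \<open>
  \<open>push\<close> is the homomorphism called \<open>T\<close> above and \<open>pull\<close> is composition with \<open>Q\<close>; \<open>push_dual\<close> and \<open>pull_dual\<close> are their
  counterparts for functionals, which are defined on the whole carrier and not only on the ball.
\<close>
definition push :: "('x \<Rightarrow> complex) \<Rightarrow> 'y \<Rightarrow> complex" where
  "push g y = (if y \<in> unit_ball Y then Lim N (\<lambda>k. g (J k y)) else 0)"

definition pull :: "('y \<Rightarrow> complex) \<Rightarrow> 'x \<Rightarrow> complex" where
  "pull f x = (if x \<in> unit_ball X then f (Q x) else 0)"

definition push_dual :: "('x \<Rightarrow> complex) \<Rightarrow> 'y \<Rightarrow> complex" where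
  "push_dual \<psi> = limit_functional (\<lambda>_. \<psi>)"

definition pull_dual :: "('y \<Rightarrow> complex) \<Rightarrow> 'x \<Rightarrow> complex" where
  "pull_dual \<phi> x = (if x \<in> carrier X then \<phi> (Q x) else 0)"

lemma push_dual_props:
  assumes "\<psi> \<in> carrier (dual X)"
  shows "push_dual \<psi> \<in> carrier (dual Y)"
    and "y \<in> carrier Y \<Longrightarrow> ((\<lambda>k. \<psi> (J k y)) \<longlongrightarrow> push_dual \<psi> y) N"
    and "nrm (dual Y) (push_dual \<psi>) \<le> nrm (dual X) \<psi>"
proof -
  interpret XD: normed_cspace "dual X" by (rule X.normed_cspace_dual)
  have 1: "\<forall>\<^sub>F k in N. \<psi> \<in> carrier (dual X)" using assms by simp
  have 2: "\<forall>\<^sub>F k in N. \<forall>x\<in>carrier X. cmod (\<psi> x) \<le> nrm (dual X) \<psi> * nrm X x"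
    using X.norm_apply_le_nrm_dual[OF assms] by simp
  have 0: "0 \<le> nrm (dual X) \<psi>" using assms by simp
  note limit_functional_mem[OF 1 0 2] and bound = limit_functional_bound[OF 1 0 2]
    and tendsto_limit_functional[OF 1 0 2]
  then show "push_dual \<psi> \<in> carrier (dual Y)"
    and "y \<in> carrier Y \<Longrightarrow> ((\<lambda>k. \<psi> (J k y)) \<longlongrightarrow> push_dual \<psi> y) N"
    by (auto simp: push_dual_def)
  show "nrm (dual Y) (push_dual \<psi>) \<le> nrm (dual X) \<psi>"
  proof (rule Y.nrm_dual_le)
    fix y assume "y \<in> closed_unit_ball Y"
    then have y: "y \<in> carrier Y" "nrm Y y \<le> 1" by (auto simp: closed_unit_ball_def)
    have "nrm (dual X) \<psi> * nrm Y y \<le> nrm (dual X) \<psi>"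
      using 0 y by (simp add: mult_left_le)
    then show "cmod (push_dual \<psi> y) \<le> nrm (dual X) \<psi>"
      using bound[OF y(1)] by (simp add: push_dual_def)
  qed
qed

lemma Q_diff: "x \<in> carrier X \<Longrightarrow> z \<in> carrier X \<Longrightarrow> Q (x - z) = Q x - Q z"
  using Q_add[of "x - z" z] by simp

lemma pull_dual_mem:
  assumes "\<phi> \<in> carrier (dual Y)"
  shows "pull_dual \<phi> \<in> carrier (dual X)"
proof -
  interpret YD: normed_cspace "dual Y" by (rule Y.normed_cspace_dual)
  have "cmod (pull_dual \<phi> x) \<le> nrm (dual Y) \<phi> * nrm X x" if "x \<in> carrier X" for x
  proof -
    have "cmod (\<phi> (Q x)) \<le> nrm (dual Y) \<phi> * nrm Y (Q x)"
      by (rule Y.norm_apply_le_nrm_dual[OF assms Q_mem[OF that]])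
    also have "\<dots> \<le> nrm (dual Y) \<phi> * nrm X x"
      using Q_nrm[OF that] assms by (intro mult_left_mono) auto
    finally show ?thesis using that by (simp add: pull_dual_def)
  qed
  moreover have "\<phi> (Q (x + z)) = \<phi> (Q x) + \<phi> (Q z)" if "x \<in> carrier X" "z \<in> carrier X" for x z
    by (simp only: Q_add[OF that] Y.dual_add[OF assms Q_mem[OF that(1)] Q_mem[OF that(2)]])
  moreover have "\<phi> (Q (smult X c x)) = c * \<phi> (Q x)" if "x \<in> carrier X" for c x
    by (simp only: Q_smult[OF that] Y.dual_smult[OF assms Q_mem[OF that]])
  ultimately show ?thesis
    unfolding X.dual_iff
    by (intro conjI ballI allI impI exI[of _ "nrm (dual Y) \<phi>"]) (simp_all add: pull_dual_def)
qed

lemma push_dual_pull_dual: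
  assumes "\<phi> \<in> carrier (dual Y)"
  shows "push_dual (pull_dual \<phi>) = \<phi>"
proof
  fix y
  show "push_dual (pull_dual \<phi>) y = \<phi> y"
  proof (cases "y \<in> carrier Y")
    case True
    have "((\<lambda>k. \<phi> (Q (J k y)) - \<phi> y) \<longlongrightarrow> 0) N"
    proof (rule Lim_null_comparison)
      show "eventually (\<lambda>k. cmod (\<phi> (Q (J k y)) - \<phi> y) \<le> nrm (dual Y) \<phi> * nrm Y (Q (J k y) - y)) N"
        using J_mem[OF True]
      proof eventually_elim
        case (elim k)
        then have "Q (J k y) \<in> carrier Y" by (rule Q_mem)
        then show ?case
          using Y.norm_apply_le_nrm_dual[OF assms, of "Q (J k y) - y"] Y.dual_diff[OF assms, of "Q (J k y)" y] True
          by simp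
      qed
      show "((\<lambda>k. nrm (dual Y) \<phi> * nrm Y (Q (J k y) - y)) \<longlongrightarrow> 0) N"
        by (rule tendsto_mult_right_zero[OF Q_J[OF True]])
    qed
    then have "((\<lambda>k. \<phi> (Q (J k y))) \<longlongrightarrow> \<phi> y) N"
      by (simp add: LIM_zero_iff)
    moreover have "eventually (\<lambda>k. \<phi> (Q (J k y)) = pull_dual \<phi> (J k y)) N"
      using J_mem[OF True] by eventually_elim (simp add: pull_dual_def)
    ultimately have "((\<lambda>k. pull_dual \<phi> (J k y)) \<longlongrightarrow> \<phi> y) N"
      by (rule Lim_transform_eventually)
    with push_dual_props(2)[OF pull_dual_mem[OF assms] True] show ?thesis
      by (rule tendsto_unique[OF nontrivial])
  next
    case False
    then show ?thesis
      by (simp add: push_dual_def limit_functional_def Y.dual_off[OF assms])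
  qed
qed

lemma Q_ball: "x \<in> unit_ball X \<Longrightarrow> Q x \<in> unit_ball Y"
  using Q_nrm[of x] Q_mem[of x] by (auto simp: X.in_unit_ball Y.in_unit_ball)

lemma ndist_Q:
  assumes "x \<in> carrier X" "z \<in> carrier X"
  shows "ndist Y (Q x) (Q z) \<le> ndist X x z"
  using assms Q_nrm[of "x - z"] Q_mem by (simp add: ndist_def Q_diff)

lemma pull_Hinf:
  assumes f: "f \<in> Hinf_algebra Y"
  shows "pull f \<in> Hinf_algebra X"
proof -
  have "analytic_on_ball X (pull f)"
    unfolding analytic_on_ball_def
  proof
    fix x assume x: "x \<in> unit_ball X"
    define D where "D = Y.frechet_deriv f (Q x)"
    have D: "D \<in> carrier (dual Y)"
      unfolding D_def by (rule Y.frechet_deriv(1)[OF f Q_ball[OF x]])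
    show "\<exists>D\<in>carrier (dual X). \<forall>e>0. \<exists>d>0. \<forall>y\<in>unit_ball X. ndist X y x < d \<longrightarrow>
        cmod (pull f y - pull f x - D (y - x)) \<le> e * ndist X y x"
    proof (intro bexI[OF _ pull_dual_mem[OF D]] allI impI)
      fix e :: real assume e: "e > 0"
      obtain d where d: "d > 0" "\<And>y. y \<in> unit_ball Y \<Longrightarrow> ndist Y y (Q x) < d \<Longrightarrow>
          cmod (f y - f (Q x) - D (y - Q x)) \<le> e * ndist Y y (Q x)"
        using Y.frechet_deriv(2)[OF f Q_ball[OF x] e] by (auto simp: D_def)
      show "\<exists>d>0. \<forall>y\<in>unit_ball X. ndist X y x < d \<longrightarrow>
        cmod (pull f y - pull f x - pull_dual D (y - x)) \<le> e * ndist X y x"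
      proof (intro exI[of _ d] conjI d(1) ballI impI)
        fix y assume y: "y \<in> unit_ball X" and "ndist X y x < d"
        have c: "x \<in> carrier X" "y \<in> carrier X" using x y by (auto simp: X.in_unit_ball)
        note le = ndist_Q[OF c(2,1)]
        have "cmod (f (Q y) - f (Q x) - D (Q y - Q x)) \<le> e * ndist Y (Q y) (Q x)"
          using le \<open>ndist X y x < d\<close> by (intro d(2) Q_ball y) simp
        also have "\<dots> \<le> e * ndist X y x"
          using le e by simp
        finally show "cmod (pull f y - pull f x - pull_dual D (y - x)) \<le> e * ndist X y x"
          using x y c by (simp add: pull_def pull_dual_def Q_diff)
      qed
    qed
  qed
  moreover obtain M where "M \<ge> 0" "\<And>x. cmod (f x) \<le> M"
    using Y.Hinf_bounded[OF f] by blast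
  then have "bounded (pull f ` unit_ball X)"
    by (auto simp: bounded_iff pull_def)
  ultimately show ?thesis
    by (auto simp: Hinf_algebra_def pull_def)
qed

lemma pull_algebra:
  assumes f: "f \<in> algebra_on H Y"
  shows "pull f \<in> algebra_on H X"
proof (cases H)
  case Hinf
  then show ?thesis using f pull_Hinf by simp
next
  case Au
  have "\<exists>d>0. \<forall>x\<in>unit_ball X. \<forall>y\<in>unit_ball X. ndist X x y < d \<longrightarrow> cmod (pull f x - pull f y) < e"
    if e: "e > 0" for e
  proof -
    obtain d where d: "d > 0" "\<And>x y. x \<in> unit_ball Y \<Longrightarrow> y \<in> unit_ball Y \<Longrightarrow>
        ndist Y x y < d \<Longrightarrow> cmod (f x - f y) < e"
      using f Au e by (auto simp: Au_algebra_def)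
    show ?thesis
    proof (intro exI[of _ d] conjI d(1) ballI impI)
      fix x y assume xy: "x \<in> unit_ball X" "y \<in> unit_ball X" "ndist X x y < d"
      then have "ndist Y (Q x) (Q y) < d"
        using ndist_Q[of x y] by (simp add: X.in_unit_ball)
      then show "cmod (pull f x - pull f y) < e"
        using d(2)[OF Q_ball Q_ball, of x y] xy by (simp add: pull_def)
    qed
  qed
  then show ?thesis
    using f Au pull_Hinf by (simp add: Au_algebra_def)
qed

lemma tendsto_push:
  assumes g: "g \<in> Hinf_algebra X" and y: "y \<in> unit_ball Y"
  shows "((\<lambda>k. g (J k y)) \<longlongrightarrow> push g y) N"
proof -
  obtain M where "M \<ge> 0" "\<And>x. cmod (g x) \<le> M"
    using X.Hinf_bounded[OF g] by blast
  then show ?thesis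
    using tendsto_LimN[of "\<lambda>k. g (J k y)" M] y by (simp add: push_def)
qed

text \<open>
  With \<open>D\<close> the limit of the derivatives of \<open>g\<close> at \<open>J k y\<close>, the remainder of \<open>push g\<close> at \<open>y\<close> is the limit of the remainders
  of \<open>g\<close> at \<open>J k y\<close>, and these are at most \<open>C \<parallel>J k z - J k y\<parallel>\<^sup>2\<close>, with limit \<open>C \<parallel>z - y\<parallel>\<^sup>2\<close>.
\<close>
lemma push_analytic:
  assumes g: "g \<in> Hinf_algebra X"
  shows "analytic_on_ball Y (push g)"
  unfolding analytic_on_ball_def
proof
  obtain M where M: "M \<ge> 0" "\<And>x. cmod (g x) \<le> M"
    using X.Hinf_bounded[OF g] by blast
  fix y assume y: "y \<in> unit_ball Y"
  then have yc: "y \<in> carrier Y" and y1: "nrm Y y < 1"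
    by (auto simp: Y.in_unit_ball)
  \<comment> \<open>Half of the distance to the sphere is kept for the estimates at \<open>J k y\<close>, whose norm exceeds that of \<open>y\<close> by at most the other half.\<close>
  define r where "r = (1 - nrm Y y) / 6"
  have r: "r > 0" "nrm Y y + 6 * r = 1"
  proof -
    show "r > 0" using y1 by (simp add: r_def)
    show "nrm Y y + 6 * r = 1" unfolding r_def by argo
  qed
  define \<psi> where "\<psi> k = X.frechet_deriv g (J k y)" for k
  have near: "eventually (\<lambda>k. nrm X (J k y) + 3 * r \<le> 1) N"
  proof -
    have "eventually (\<lambda>k. nrm X (J k y) < nrm Y y + 3 * r) N"
      by (rule order_tendstoD(2)[OF J_nrm[OF yc]]) (use r(1) in simp)
    then show ?thesis
      by eventually_elim (use r(2) in linarith)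
  qed
  have 1: "eventually (\<lambda>k. \<psi> k \<in> carrier (dual X)) N"
    using J_ball[OF y] by eventually_elim (simp add: \<psi>_def X.frechet_deriv(1)[OF g])
  have 0: "0 \<le> M / r" using M(1) r(1) by simp
  have 2: "eventually (\<lambda>k. \<forall>x\<in>carrier X. cmod (\<psi> k x) \<le> M / r * nrm X x) N"
    using J_mem[OF yc] near
  proof eventually_elim
    case (elim k)
    show ?case
      unfolding \<psi>_def by (intro ballI X.frechet_deriv_bound[OF g M elim(1) r(1) elim(2)])
  qed
  define D where "D = limit_functional \<psi>"
  have D: "D \<in> carrier (dual Y)"
    unfolding D_def by (rule limit_functional_mem[OF 1 0 2])
  define C where "C = 2 * M / r\<^sup>2"
  have C: "C \<ge> 0" using M(1) by (simp add: C_def)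
  have est: "cmod (push g z - push g y - D (z - y)) \<le> C * (nrm Y (z - y))\<^sup>2"
    if z: "z \<in> unit_ball Y" and zr: "nrm Y (z - y) < r" for z
  proof (rule tendsto_le[OF nontrivial])
    have zc: "z \<in> carrier Y" using z by (simp add: Y.in_unit_ball)
    then have w: "z - y \<in> carrier Y" using yc by simp
    \<comment> \<open>The estimates apply to the increment \<open>J k z - J k y\<close>, while \<open>D\<close> is the limit at \<open>J k (z - y)\<close>.\<close>
    have "((\<lambda>k. \<psi> k (J k z - J k y - J k (z - y))) \<longlongrightarrow> 0) N"
      by (rule functional_null[OF 1 0 2 _ J_diff(1)[OF zc yc]])
        (use J_mem[OF zc] J_mem[OF yc] J_mem[OF w] in \<open>eventually_elim, simp\<close>)
    from tendsto_diff[OF tendsto_diff[OF tendsto_diff[OF tendsto_push[OF g z] tendsto_push[OF g y]]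
        tendsto_limit_functional[OF 1 0 2 w]] this]
    have "((\<lambda>k. g (J k z) - g (J k y) - \<psi> k (J k (z - y)) - \<psi> k (J k z - J k y - J k (z - y)))
        \<longlongrightarrow> push g z - push g y - D (z - y)) N"
      by (simp add: D_def)
    moreover have "eventually (\<lambda>k. g (J k z) - g (J k y) - \<psi> k (J k (z - y)) - \<psi> k (J k z - J k y - J k (z - y))
        = g (J k z) - g (J k y) - \<psi> k (J k z - J k y)) N"
      using 1 J_mem[OF zc] J_mem[OF yc] J_mem[OF w]
    proof eventually_elim
      case (elim k)
      note d = X.dual_diff[OF elim(1)]
      show ?case
        using d[OF X.diff_mem[OF elim(2,3)] elim(4)] by simp
    qed
    ultimately have "((\<lambda>k. g (J k z) - g (J k y) - \<psi> k (J k z - J k y)) \<longlongrightarrow> push g z - push g y - D (z - y)) N"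
      by (rule Lim_transform_eventually)
    then show "((\<lambda>k. cmod (g (J k z) - g (J k y) - \<psi> k (J k z - J k y))) \<longlongrightarrow> cmod (push g z - push g y - D (z - y))) N"
      by (rule tendsto_norm)
    show "((\<lambda>k. C * (nrm X (J k z - J k y))\<^sup>2) \<longlongrightarrow> C * (nrm Y (z - y))\<^sup>2) N"
      by (intro tendsto_mult_left tendsto_power J_diff(2) zc yc)
    show "eventually (\<lambda>k. cmod (g (J k z) - g (J k y) - \<psi> k (J k z - J k y)) \<le> C * (nrm X (J k z - J k y))\<^sup>2) N"
      using order_tendstoD(2)[OF J_diff(2)[OF zc yc] zr] near J_mem[OF zc] J_mem[OF yc]
    proof eventually_elim
      case (elim k)
      then show ?case
        using X.frechet_deriv_estimates(1)[OF g M elim(4) r(1) elim(2), of "J k z - J k y"]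
        by (simp add: \<psi>_def C_def)
    qed
  qed
  show "\<exists>D\<in>carrier (dual Y). \<forall>e>0. \<exists>d>0. \<forall>z\<in>unit_ball Y. ndist Y z y < d \<longrightarrow>
      cmod (push g z - push g y - D (z - y)) \<le> e * ndist Y z y"
  proof (intro bexI[OF _ D] allI impI)
    fix e :: real assume e: "e > 0"
    define d where "d = min r (e / (C + 1))"
    have d: "d > 0" using r(1) e C by (simp add: d_def)
    show "\<exists>d>0. \<forall>z\<in>unit_ball Y. ndist Y z y < d \<longrightarrow>
      cmod (push g z - push g y - D (z - y)) \<le> e * ndist Y z y"
    proof (intro exI[of _ d] conjI d ballI impI)
      fix z assume z: "z \<in> unit_ball Y" "ndist Y z y < d"
      have zc: "z \<in> carrier Y" using z by (simp add: Y.in_unit_ball)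
      define n where "n = nrm Y (z - y)"
      have n: "n \<ge> 0" "ndist Y z y = n"
        using zc yc by (simp_all add: n_def ndist_def)
      have "n < r" "n < e / (C + 1)" using z n by (auto simp: d_def)
      have "C * n \<le> (C + 1) * n" using n by (intro mult_right_mono) auto
      also have "\<dots> \<le> e"
        using \<open>n < e / (C + 1)\<close> C by (simp add: pos_less_divide_eq mult.commute)
      finally have "C * n * n \<le> e * n"
        using n by (intro mult_right_mono) auto
      then show "cmod (push g z - push g y - D (z - y)) \<le> e * ndist Y z y"
        using est[OF z(1)] \<open>n < r\<close> n by (simp add: power2_eq_square flip: n_def)
    qed
  qed
qed

lemma push_Hinf:
  assumes g: "g \<in> Hinf_algebra X"
  shows "push g \<in> Hinf_algebra Y"
proof -
  obtain M where M: "M \<ge> 0" "\<And>x. cmod (g x) \<le> M"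
    using X.Hinf_bounded[OF g] by blast
  have "cmod (push g y) \<le> M" if "y \<in> unit_ball Y" for y
    by (rule Lim_norm_ubound[OF nontrivial tendsto_push[OF g that]]) (simp add: M)
  then have "bounded (push g ` unit_ball Y)"
    by (auto simp: bounded_iff)
  then show ?thesis
    using push_analytic[OF g] by (auto simp: Hinf_algebra_def push_def)
qed

lemma algebra_Hinf: "f \<in> algebra_on H Z \<Longrightarrow> f \<in> Hinf_algebra Z"
  by (cases H) (auto simp: Au_algebra_def)

text \<open>
  Uniform continuity passes to the limit because \<open>\<parallel>J k y - J k z\<parallel>\<close> tends to \<open>\<parallel>y - z\<parallel>\<close>.
\<close>
lemma push_algebra:
  assumes g: "g \<in> algebra_on H X"
  shows "push g \<in> algebra_on H Y"
proof (cases H)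
  case Hinf
  then show ?thesis using g push_Hinf by simp
next
  case Au
  note gH = algebra_Hinf[OF g]
  have "\<exists>d>0. \<forall>x\<in>unit_ball Y. \<forall>y\<in>unit_ball Y. ndist Y x y < d \<longrightarrow> cmod (push g x - push g y) < e"
    if e: "e > 0" for e
  proof -
    have "\<forall>e>0. \<exists>d>0. \<forall>x\<in>unit_ball X. \<forall>y\<in>unit_ball X. ndist X x y < d \<longrightarrow> cmod (g x - g y) < e"
      using g Au by (simp add: Au_algebra_def)
    moreover have "e / 2 > 0" using e by simp
    ultimately obtain d where d: "d > 0" "\<And>x y. x \<in> unit_ball X \<Longrightarrow> y \<in> unit_ball X \<Longrightarrow>
        ndist X x y < d \<Longrightarrow> cmod (g x - g y) < e / 2"
      by blast
    show ?thesis
    proof (intro exI[of _ d] conjI d(1) ballI impI)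
      fix y z assume y: "y \<in> unit_ball Y" and z: "z \<in> unit_ball Y" and yz: "ndist Y y z < d"
      have c: "y \<in> carrier Y" "z \<in> carrier Y" using y z by (auto simp: Y.in_unit_ball)
      have "eventually (\<lambda>k. nrm X (J k y - J k z) < d) N"
        by (rule order_tendstoD(2)[OF J_diff(2)[OF c]]) (use yz c in \<open>simp add: ndist_def\<close>)
      then have "eventually (\<lambda>k. cmod (g (J k y) - g (J k z)) \<le> e / 2) N"
        using J_ball[OF y] J_ball[OF z]
      proof eventually_elim
        case (elim k)
        then show ?case
          using d(2)[of "J k y" "J k z"] by (simp add: ndist_def X.in_unit_ball)
      qed
      then have "cmod (push g y - push g z) \<le> e / 2"
        by (rule Lim_norm_ubound[OF nontrivial tendsto_diff[OF tendsto_push[OF gH y] tendsto_push[OF gH z]]])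
      then show "cmod (push g y - push g z) < e" using e by simp
    qed
  qed
  then show ?thesis
    using g Au push_Hinf[OF gH] by (simp add: Au_algebra_def)
qed

lemma push_eqI:
  assumes "\<And>y. y \<in> unit_ball Y \<Longrightarrow> ((\<lambda>k. g (J k y)) \<longlongrightarrow> f y) N"
    and "\<And>y. y \<notin> unit_ball Y \<Longrightarrow> f y = 0"
  shows "push g = f"
proof
  show "push g y = f y" for y
    using tendsto_Lim[OF nontrivial assms(1), of y] assms(2)[of y] by (simp add: push_def)
qed

lemma push_hom:
  assumes f: "f \<in> Hinf_algebra X" and g: "g \<in> Hinf_algebra X"
  shows "push (\<lambda>x. f x + g x) = (\<lambda>y. push f y + push g y)"
    and "push (\<lambda>x. f x * g x) = (\<lambda>y. push f y * push g y)"
    and "push (\<lambda>x. c * f x) = (\<lambda>y. c * push f y)"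
  by (rule push_eqI, (intro tendsto_add tendsto_mult tendsto_mult_left tendsto_push f g; assumption),
    simp add: push_def)+

text \<open>
  Continuity of \<open>f\<close> at \<open>y\<close> suffices, because \<open>Q (J k y)\<close> tends to \<open>y\<close>.
\<close>
lemma push_pull:
  assumes f: "f \<in> Hinf_algebra Y"
  shows "push (pull f) = f"
proof (rule push_eqI)
  fix y assume y: "y \<in> unit_ball Y"
  then have yc: "y \<in> carrier Y" and y1: "nrm Y y < 1"
    by (auto simp: Y.in_unit_ball)
  obtain M where M: "M \<ge> 0" "\<And>x. cmod (f x) \<le> M"
    using Y.Hinf_bounded[OF f] by blast
  define r where "r = (1 - nrm Y y) / 3"
  have r: "r > 0" "nrm Y y + 3 * r \<le> 1"
  proof -
    show "r > 0" using y1 by (simp add: r_def)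
    show "nrm Y y + 3 * r \<le> 1" unfolding r_def by argo
  qed
  have "((\<lambda>k. pull f (J k y) - f y) \<longlongrightarrow> 0) N"
  proof (rule Lim_null_comparison)
    show "((\<lambda>k. 3 * M / r * nrm Y (Q (J k y) - y)) \<longlongrightarrow> 0) N"
      by (rule tendsto_mult_right_zero[OF Q_J[OF yc]])
    show "eventually (\<lambda>k. cmod (pull f (J k y) - f y) \<le> 3 * M / r * nrm Y (Q (J k y) - y)) N"
      using J_ball[OF y] order_tendstoD(2)[OF Q_J[OF yc] r(1)]
    proof eventually_elim
      case (elim k)
      then have "Q (J k y) \<in> carrier Y" using Q_mem by (simp add: X.in_unit_ball)
      then show ?case
        using Y.Hinf_locally_Lipschitz[OF f M yc r, of "Q (J k y)"] elim by (simp add: pull_def)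
    qed
  qed
  then show "((\<lambda>k. pull f (J k y)) \<longlongrightarrow> f y) N"
    by (simp add: LIM_zero_iff)
qed (use f in \<open>simp add: Hinf_algebra_def\<close>)

lemma push_restrict_ball:
  assumes \<psi>: "\<psi> \<in> carrier (dual X)"
  shows "push (restrict_ball X \<psi>) = restrict_ball Y (push_dual \<psi>)"
proof (rule push_eqI)
  fix y assume y: "y \<in> unit_ball Y"
  have "((\<lambda>k. \<psi> (J k y)) \<longlongrightarrow> push_dual \<psi> y) N"
    by (rule push_dual_props(2)[OF \<psi>]) (use y in \<open>simp add: Y.in_unit_ball\<close>)
  moreover have "eventually (\<lambda>k. \<psi> (J k y) = restrict_ball X \<psi> (J k y)) N"
    using J_ball[OF y] by eventually_elim (simp add: restrict_ball_def)
  ultimately have "((\<lambda>k. restrict_ball X \<psi> (J k y)) \<longlongrightarrow> push_dual \<psi> y) N"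
    by (rule Lim_transform_eventually)
  then show "((\<lambda>k. restrict_ball X \<psi> (J k y)) \<longlongrightarrow> restrict_ball Y (push_dual \<psi>) y) N"
    using y by (simp add: restrict_ball_def)
qed (simp add: restrict_ball_def)

lemma push_dual_linear:
  assumes "\<phi> \<in> carrier (dual X)" "\<psi> \<in> carrier (dual X)"
  shows "push_dual (\<phi> + \<psi>) = push_dual \<phi> + push_dual \<psi>"
    and "push_dual (\<lambda>x. c * \<phi> x) = (\<lambda>y. c * push_dual \<phi> y)"
proof -
  show "push_dual (\<phi> + \<psi>) = push_dual \<phi> + push_dual \<psi>"
  proof
    show "push_dual (\<phi> + \<psi>) y = (push_dual \<phi> + push_dual \<psi>) y" for y
      using tendsto_Lim[OF nontrivial tendsto_add[OF push_dual_props(2)[OF assms(1)] push_dual_props(2)[OF assms(2)]], of y]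
      by (simp add: push_dual_def limit_functional_def)
  qed
  show "push_dual (\<lambda>x. c * \<phi> x) = (\<lambda>y. c * push_dual \<phi> y)"
  proof
    show "push_dual (\<lambda>x. c * \<phi> x) y = c * push_dual \<phi> y" for y
      using tendsto_Lim[OF nontrivial tendsto_mult_left[OF push_dual_props(2)[OF assms(1)]], of y c]
      by (simp add: push_dual_def limit_functional_def)
  qed
qed

text \<open>
  The weak-star limit point over which the transported functionals lie.
\<close>
definition lift_bidual :: "(('y \<Rightarrow> complex) \<Rightarrow> complex) \<Rightarrow> ('x \<Rightarrow> complex) \<Rightarrow> complex" where
  "lift_bidual \<xi> \<psi> = (if \<psi> \<in> carrier (dual X) then \<xi> (push_dual \<psi>) else 0)"

lemma lift_bidual_mem:
  assumes \<xi>: "\<xi> \<in> closed_unit_ball (dual (dual Y))"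
  shows "lift_bidual \<xi> \<in> closed_unit_ball (dual (dual X))"
proof -
  interpret XD: normed_cspace "dual X" by (rule X.normed_cspace_dual)
  interpret YD: normed_cspace "dual Y" by (rule Y.normed_cspace_dual)
  have \<xi>c: "\<xi> \<in> carrier (dual (dual Y))" and \<xi>1: "nrm (dual (dual Y)) \<xi> \<le> 1"
    using \<xi> by (auto simp: closed_unit_ball_def)
  have bound: "cmod (lift_bidual \<xi> \<psi>) \<le> nrm (dual X) \<psi>" if "\<psi> \<in> carrier (dual X)" for \<psi>
  proof -
    note p = push_dual_props[OF that]
    have "cmod (\<xi> (push_dual \<psi>)) \<le> nrm (dual (dual Y)) \<xi> * nrm (dual Y) (push_dual \<psi>)"
      by (rule YD.norm_apply_le_nrm_dual[OF \<xi>c p(1)])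
    also have "\<dots> \<le> 1 * nrm (dual Y) (push_dual \<psi>)"
      using \<xi>1 p(1) by (intro mult_right_mono) auto
    finally show ?thesis
      using p(3) that by (simp add: lift_bidual_def)
  qed
  have sm: "smult (dual X) c \<psi> = (\<lambda>x. c * \<psi> x)" "smult (dual Y) c \<phi> = (\<lambda>x. c * \<phi> x)" for c \<psi> \<phi>
    by (simp_all add: dual_def)
  have "lift_bidual \<xi> \<in> carrier (dual (dual X))"
    unfolding XD.dual_iff
  proof (intro conjI ballI allI impI)
    fix \<phi> \<psi> assume a: "\<phi> \<in> carrier (dual X)" "\<psi> \<in> carrier (dual X)"
    have "\<xi> (push_dual \<phi> + push_dual \<psi>) = \<xi> (push_dual \<phi>) + \<xi> (push_dual \<psi>)"
      by (intro YD.dual_add[OF \<xi>c] push_dual_props(1) a)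
    then show "lift_bidual \<xi> (\<phi> + \<psi>) = lift_bidual \<xi> \<phi> + lift_bidual \<xi> \<psi>"
      using a by (simp add: lift_bidual_def push_dual_linear)
  next
    fix c \<phi> assume a: "\<phi> \<in> carrier (dual X)"
    have "\<xi> (smult (dual Y) c (push_dual \<phi>)) = c * \<xi> (push_dual \<phi>)"
      by (intro YD.dual_smult[OF \<xi>c] push_dual_props(1) a)
    then show "lift_bidual \<xi> (smult (dual X) c \<phi>) = c * lift_bidual \<xi> \<phi>"
      using a XD.smult_mem[OF a, of c] by (simp add: lift_bidual_def sm push_dual_linear(2)[OF a a])
  next
    show "\<exists>K. \<forall>\<psi>\<in>carrier (dual X). cmod (lift_bidual \<xi> \<psi>) \<le> K * nrm (dual X) \<psi>"
      using bound by (intro exI[of _ 1]) simp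
  qed (simp add: lift_bidual_def)
  moreover have "nrm (dual (dual X)) (lift_bidual \<xi>) \<le> 1"
    by (rule XD.nrm_dual_le) (use bound in \<open>force simp: closed_unit_ball_def\<close>)
  ultimately show ?thesis
    by (simp add: closed_unit_ball_def)
qed

text \<open>
  If \<open>\<tau> f \<noteq> 0\<close>, then \<open>push (pull f) = f\<close> shows that the composition does not vanish at \<open>pull f\<close>.
\<close>
lemma fiber_push:
  assumes \<tau>: "\<tau> \<in> fiber H Y \<xi>"
  shows "(\<lambda>g. \<tau> (push g)) \<in> fiber H X (lift_bidual \<xi>)"
proof -
  have m: "multiplicative_functional H Y \<tau>"
    and \<xi>: "\<And>\<phi>. \<phi> \<in> carrier (dual Y) \<Longrightarrow> \<tau> (restrict_ball Y \<phi>) = \<xi> \<phi>"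
    using \<tau> by (auto simp: fiber_def)
  obtain f where f: "f \<in> algebra_on H Y" "\<tau> f \<noteq> 0"
    using m by (auto simp: multiplicative_functional_def)
  have "pull f \<in> algebra_on H X" "\<tau> (push (pull f)) \<noteq> 0"
    using f pull_algebra push_pull[OF algebra_Hinf] by auto
  then have "\<exists>g\<in>algebra_on H X. \<tau> (push g) \<noteq> 0" by blast
  moreover have "\<tau> (push (\<lambda>x. g x + h x)) = \<tau> (push g) + \<tau> (push h)"
    and "\<tau> (push (\<lambda>x. g x * h x)) = \<tau> (push g) * \<tau> (push h)"
    and "\<tau> (push (\<lambda>x. c * g x)) = c * \<tau> (push g)"
    if "g \<in> algebra_on H X" "h \<in> algebra_on H X" for g h c
    using m that[THEN push_algebra] unfolding multiplicative_functional_def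
    by (simp_all only: push_hom[OF that[THEN algebra_Hinf]])
  ultimately have "multiplicative_functional H X (\<lambda>g. \<tau> (push g))"
    unfolding multiplicative_functional_def by blast
  moreover have "\<tau> (push (restrict_ball X \<psi>)) = lift_bidual \<xi> \<psi>" if "\<psi> \<in> carrier (dual X)" for \<psi>
    using that \<xi> push_dual_props(1)[OF that] by (simp add: push_restrict_ball lift_bidual_def)
  ultimately show ?thesis
    by (simp add: fiber_def)
qed

text \<open>
  Weak-star convergence in \<open>X\<close> is tested on the functionals \<open>\<phi> \<circ> Q\<close>, at which the lifted point has the value \<open>\<xi> \<phi>\<close>.
\<close>
lemma cluster_set_pull:
  "cluster_set X (pull f) (lift_bidual \<xi>) \<subseteq> cluster_set Y f \<xi>"
proof
  fix w assume "w \<in> cluster_set X (pull f) (lift_bidual \<xi>)"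
  then obtain K where K: "K \<noteq> bot" "K \<le> principal (unit_ball X)"
    and conv: "\<And>\<psi>. \<psi> \<in> carrier (dual X) \<Longrightarrow> (\<psi> \<longlongrightarrow> lift_bidual \<xi> \<psi>) K" and w: "(pull f \<longlongrightarrow> w) K"
    by (auto simp: cluster_set_def)
  have ball: "eventually (\<lambda>x. x \<in> unit_ball X) K"
    using K(2) by (simp add: le_principal)
  have "(f \<longlongrightarrow> w) (filtermap Q K)"
  proof -
    have "eventually (\<lambda>x. pull f x = f (Q x)) K"
      using ball by eventually_elim (simp add: pull_def)
    with w show ?thesis
      unfolding filterlim_filtermap by (rule Lim_transform_eventually)
  qed
  moreover have "(\<phi> \<longlongrightarrow> \<xi> \<phi>) (filtermap Q K)" if \<phi>: "\<phi> \<in> carrier (dual Y)" for \<phi>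
  proof -
    have "(pull_dual \<phi> \<longlongrightarrow> \<xi> \<phi>) K"
      using conv[OF pull_dual_mem[OF \<phi>]] \<phi>
      by (simp add: lift_bidual_def pull_dual_mem push_dual_pull_dual)
    moreover have "eventually (\<lambda>x. pull_dual \<phi> x = \<phi> (Q x)) K"
      using ball by eventually_elim (simp add: pull_dual_def X.in_unit_ball)
    ultimately show ?thesis
      unfolding filterlim_filtermap by (rule Lim_transform_eventually)
  qed
  moreover have "filtermap Q K \<noteq> bot"
    using K(1) by (simp add: filtermap_bot_iff)
  moreover have "filtermap Q K \<le> principal (unit_ball Y)"
    unfolding le_principal eventually_filtermap
    using ball by eventually_elim (rule Q_ball)
  ultimately show "w \<in> cluster_set Y f \<xi>"
    unfolding cluster_set_def by blast
qed

lemma cluster_value_theorem_transfer: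
  assumes "satisfies_cluster_value_theorem H X"
  shows "satisfies_cluster_value_theorem H Y"
  unfolding satisfies_cluster_value_theorem_def cluster_value_theorem_at_def
proof (intro ballI subsetI)
  fix \<xi> f w
  assume \<xi>: "\<xi> \<in> closed_unit_ball (dual (dual Y))" and f: "f \<in> algebra_on H Y"
    and "w \<in> {\<tau> f | \<tau>. \<tau> \<in> fiber H Y \<xi>}"
  then obtain \<tau> where \<tau>: "\<tau> \<in> fiber H Y \<xi>" and w: "w = \<tau> f" by blast
  have "\<tau> (push (pull f)) \<in> cluster_set X (pull f) (lift_bidual \<xi>)"
    using assms lift_bidual_mem[OF \<xi>] pull_algebra[OF f] fiber_push[OF \<tau>]
    unfolding satisfies_cluster_value_theorem_def cluster_value_theorem_at_def by blast
  then show "w \<in> cluster_set Y f \<xi>"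
    using cluster_set_pull by (auto simp: w push_pull[OF algebra_Hinf[OF f]])
qed

end

section \<open>The \<open>\<ell>\<^sub>1\<close> sum as a normed space\<close>

locale subspace_family = Y: normed_cspace Y for Y :: "('y::ab_group_add) cspace" +
  fixes A :: "'a set" and F :: "'a \<Rightarrow> 'y set"
  assumes F_subspace: "\<And>\<alpha>. \<alpha> \<in> A \<Longrightarrow> Y.subspace (F \<alpha>)"
    and F_carrier: "\<And>\<alpha>. \<alpha> \<in> A \<Longrightarrow> F \<alpha> \<subseteq> carrier Y"
begin

abbreviation X where "X \<equiv> ell1_sum Y A F"

lemma ell1_mem_iff:
  "z \<in> carrier X \<longleftrightarrow> (\<forall>\<alpha>\<in>A. z \<alpha> \<in> F \<alpha>) \<and> (\<forall>\<alpha>. \<alpha> \<notin> A \<longrightarrow> z \<alpha> = 0) \<and>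
     (\<lambda>\<alpha>. nrm Y (z \<alpha>)) summable_on A"
  by (simp add: ell1_sum_def)

lemma ell1_nrm: "nrm X z = (\<Sum>\<^sub>\<infinity>\<alpha>\<in>A. nrm Y (z \<alpha>))"
  by (simp add: ell1_sum_def)

lemma ell1_smult: "smult X c z = (\<lambda>\<alpha>. smult Y c (z \<alpha>))"
  by (simp add: ell1_sum_def)

lemma ell1_summable: "z \<in> carrier X \<Longrightarrow> (\<lambda>\<alpha>. nrm Y (z \<alpha>)) summable_on A"
  by (simp add: ell1_mem_iff)

lemma ell1_component: "z \<in> carrier X \<Longrightarrow> \<alpha> \<in> A \<Longrightarrow> z \<alpha> \<in> carrier Y"
  using F_carrier by (auto simp: ell1_mem_iff)

lemma ell1_add_mem:
  assumes z: "z \<in> carrier X" and w: "w \<in> carrier X"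
  shows "z + w \<in> carrier X"
proof -
  have "(\<lambda>\<alpha>. nrm Y (z \<alpha> + w \<alpha>)) summable_on A"
    by (rule summable_on_comparison_test[OF summable_on_add[OF ell1_summable[OF z] ell1_summable[OF w]]])
      (intro Y.nrm_add Y.nrm_nonneg Y.add_mem ell1_component z w; assumption)+
  then show ?thesis
    using z w Y.subspace_add[OF F_subspace] by (simp add: ell1_mem_iff)
qed

lemma ell1_smult_mem:
  assumes z: "z \<in> carrier X"
  shows "smult X c z \<in> carrier X"
proof -
  have "(\<lambda>\<alpha>. cmod c * nrm Y (z \<alpha>)) summable_on A"
    by (rule summable_on_cmult_right[OF ell1_summable[OF z]])
  moreover have "nrm Y (smult Y c (z \<alpha>)) = cmod c * nrm Y (z \<alpha>)" if "\<alpha> \<in> A" for \<alpha>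
    by (rule Y.nrm_smult[OF ell1_component[OF z that]])
  ultimately have "(\<lambda>\<alpha>. nrm Y (smult Y c (z \<alpha>))) summable_on A"
    using summable_on_cong[of A "\<lambda>\<alpha>. nrm Y (smult Y c (z \<alpha>))" "\<lambda>\<alpha>. cmod c * nrm Y (z \<alpha>)"] by simp
  then show ?thesis
    using z Y.subspace_scale[OF F_subspace] by (simp add: ell1_mem_iff ell1_smult)
qed

lemma normed_cspace_ell1: "normed_cspace X"
proof
  have vs: "vector_space (smult X)"
    by unfold_locales
      (auto simp: ell1_smult fun_eq_iff Y.scale_right_distrib Y.scale_left_distrib)
  interpret vector_space "smult X" by (rule vs)
  show "complex_normed_space X"
    unfolding complex_normed_space_def
  proof (intro conjI ballI allI)
    show "vector_space (smult X)" by (rule vs)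
    show "subspace (carrier X)"
    proof (rule subspaceI)
      show "0 \<in> carrier X"
        using Y.subspace_0[OF F_subspace] by (simp add: ell1_mem_iff)
    qed (auto intro: ell1_add_mem ell1_smult_mem)
  next
    fix z assume z: "z \<in> carrier X"
    have nn: "0 \<le> nrm Y (z \<alpha>)" if "\<alpha> \<in> A" for \<alpha>
      by (rule Y.nrm_nonneg[OF ell1_component[OF z that]])
    show "0 \<le> nrm X z"
      unfolding ell1_nrm by (rule infsum_nonneg[OF nn])
    show "nrm X z = 0 \<longleftrightarrow> z = 0"
    proof
      assume "nrm X z = 0"
      then have 0: "nrm Y (z \<alpha>) = 0" if "\<alpha> \<in> A" for \<alpha>
        using nonneg_infsum_le_0D[OF _ ell1_summable[OF z] nn that] by (simp add: ell1_nrm)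
      have "z \<alpha> = 0" for \<alpha>
      proof (cases "\<alpha> \<in> A")
        case True
        then show ?thesis
          using 0[OF True] Y.nrm_eq_0_iff[OF ell1_component[OF z True]] by simp
      next
        case False
        then show ?thesis using z by (simp add: ell1_mem_iff)
      qed
      then show "z = 0" by (simp add: fun_eq_iff)
    qed (simp add: ell1_nrm)
  next
    fix z w assume z: "z \<in> carrier X" and w: "w \<in> carrier X"
    have "nrm X (z + w) \<le> (\<Sum>\<^sub>\<infinity>\<alpha>\<in>A. nrm Y (z \<alpha>) + nrm Y (w \<alpha>))"
      unfolding ell1_nrm
      by (intro infsum_mono ell1_summable ell1_add_mem summable_on_add z w)
        (auto intro!: Y.nrm_add ell1_component z w)
    also have "\<dots> = nrm X z + nrm X w"
      unfolding ell1_nrm by (rule infsum_add[OF ell1_summable[OF z] ell1_summable[OF w]])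
    finally show "nrm X (z + w) \<le> nrm X z + nrm X w" .
  next
    fix c z assume z: "z \<in> carrier X"
    have "nrm X (smult X c z) = (\<Sum>\<^sub>\<infinity>\<alpha>\<in>A. cmod c * nrm Y (z \<alpha>))"
      unfolding ell1_nrm ell1_smult
      by (rule infsum_cong) (rule Y.nrm_smult[OF ell1_component[OF z]])
    then show "nrm X (smult X c z) = cmod c * nrm X z"
      by (simp add: ell1_nrm infsum_cmult_right')
  qed
qed

sublocale X: normed_cspace X
  by (rule normed_cspace_ell1)

section \<open>Coordinate embeddings\<close>

definition single :: "'a \<Rightarrow> 'y \<Rightarrow> 'a \<Rightarrow> 'y" where
  "single \<alpha> v = (\<lambda>\<beta>. if \<beta> = \<alpha> then v else 0)"

lemma single_has_sum:
  assumes "\<alpha> \<in> A"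
  shows "((\<lambda>\<beta>. nrm Y (single \<alpha> v \<beta>)) has_sum nrm Y v) A"
proof -
  have "((\<lambda>\<beta>. nrm Y (single \<alpha> v \<beta>)) has_sum nrm Y v) {\<alpha>}"
    using has_sum_finite[of "{\<alpha>}" "\<lambda>\<beta>. nrm Y (single \<alpha> v \<beta>)"] by (simp add: single_def)
  then show ?thesis
    using assms by (subst has_sum_cong_neutral[where T = "{\<alpha>}"]) (auto simp: single_def)
qed

lemma single_mem: "\<alpha> \<in> A \<Longrightarrow> v \<in> F \<alpha> \<Longrightarrow> single \<alpha> v \<in> carrier X"
  using has_sum_imp_summable[OF single_has_sum] Y.subspace_0[OF F_subspace]
  by (auto simp: ell1_mem_iff single_def)

lemma nrm_single: "\<alpha> \<in> A \<Longrightarrow> nrm X (single \<alpha> v) = nrm Y v"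
  unfolding ell1_nrm by (rule infsumI[OF single_has_sum])

lemma single_diff: "single \<alpha> (v - w) = single \<alpha> v - single \<alpha> w"
  by (auto simp: single_def fun_eq_iff)

lemma single_smult: "single \<alpha> (smult Y c v) = smult X c (single \<alpha> v)"
  by (auto simp: single_def fun_eq_iff ell1_smult)

section \<open>The summation map\<close>

text \<open>
  Convergence of the series is expressed by norms because \<open>Y\<close> carries no topology as a type.
\<close>
definition sums_to :: "('a \<Rightarrow> 'y) \<Rightarrow> 'y \<Rightarrow> bool" where
  "sums_to z y \<longleftrightarrow> y \<in> carrier Y \<and>
     ((\<lambda>S. nrm Y (sum z S - y)) \<longlongrightarrow> 0) (finite_subsets_at_top A)"

definition total :: "('a \<Rightarrow> 'y) \<Rightarrow> 'y" where
  "total z = (SOME y. sums_to z y)"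

lemma eventually_sum_mem:
  assumes "z \<in> carrier X"
  shows "eventually (\<lambda>S. sum z S \<in> carrier Y) (finite_subsets_at_top A)"
  by (rule eventually_finite_subsets_at_top_weakI) (auto intro!: Y.sum_mem ell1_component assms)

lemma sums_to_unique:
  assumes z: "z \<in> carrier X" and y: "sums_to z y" and y': "sums_to z y'"
  shows "y = y'"
proof -
  have c: "y \<in> carrier Y" "y' \<in> carrier Y"
    using y y' by (auto simp: sums_to_def)
  have "((\<lambda>S. nrm Y (sum z S - y) + nrm Y (sum z S - y')) \<longlongrightarrow> 0 + 0) (finite_subsets_at_top A)"
    using y y' unfolding sums_to_def by (intro tendsto_add) auto
  moreover have "eventually (\<lambda>S. nrm Y (y - y') \<le> nrm Y (sum z S - y) + nrm Y (sum z S - y'))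
      (finite_subsets_at_top A)"
    using eventually_sum_mem[OF z]
  proof eventually_elim
    case (elim S)
    show ?case
      using Y.nrm_triangle3[OF c(1) elim c(2)] Y.nrm_minus_commute[OF c(1) elim] by simp
  qed
  ultimately have "nrm Y (y - y') \<le> 0 + 0"
    by (rule tendsto_lowerbound) simp
  then show ?thesis
    using Y.nrm_nonneg[OF Y.diff_mem[OF c]] Y.nrm_eq_0_iff[OF Y.diff_mem[OF c]] by simp
qed

lemma total_eqI: "z \<in> carrier X \<Longrightarrow> sums_to z y \<Longrightarrow> total z = y"
  unfolding total_def by (rule some_equality) (auto intro: sums_to_unique)

lemma sums_to_single:
  assumes \<alpha>: "\<alpha> \<in> A" and v: "v \<in> F \<alpha>"
  shows "sums_to (single \<alpha> v) v"
  unfolding sums_to_def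
proof
  show "v \<in> carrier Y" using F_carrier[OF \<alpha>] v by blast
  have "eventually (\<lambda>S. nrm Y (sum (single \<alpha> v) S - v) = 0) (finite_subsets_at_top A)"
    unfolding eventually_finite_subsets_at_top
    by (rule exI[of _ "{\<alpha>}"]) (use \<alpha> in \<open>auto simp: single_def\<close>)
  then show "((\<lambda>S. nrm Y (sum (single \<alpha> v) S - v)) \<longlongrightarrow> 0) (finite_subsets_at_top A)"
    by (rule tendsto_eventually)
qed

lemma sums_to_add:
  assumes z: "z \<in> carrier X" "sums_to z y" and w: "w \<in> carrier X" "sums_to w x"
  shows "sums_to (z + w) (y + x)"
  unfolding sums_to_def
proof
  have c: "y \<in> carrier Y" "x \<in> carrier Y"
    using z w by (auto simp: sums_to_def)
  then show "y + x \<in> carrier Y" by simp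
  show "((\<lambda>S. nrm Y (sum (z + w) S - (y + x))) \<longlongrightarrow> 0) (finite_subsets_at_top A)"
  proof (rule Lim_null_comparison)
    show "((\<lambda>S. nrm Y (sum z S - y) + nrm Y (sum w S - x)) \<longlongrightarrow> 0) (finite_subsets_at_top A)"
      using z w unfolding sums_to_def by (intro tendsto_add_zero) auto
    show "eventually (\<lambda>S. norm (nrm Y (sum (z + w) S - (y + x)))
        \<le> nrm Y (sum z S - y) + nrm Y (sum w S - x)) (finite_subsets_at_top A)"
      using eventually_sum_mem[OF z(1)] eventually_sum_mem[OF w(1)]
    proof eventually_elim
      case (elim S)
      have "sum (z + w) S - (y + x) = (sum z S - y) + (sum w S - x)"
        by (simp add: sum.distrib)
      moreover have "sum z S - y \<in> carrier Y" "sum w S - x \<in> carrier Y"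
        using elim c by simp_all
      ultimately show ?case
        using Y.nrm_add[of "sum z S - y" "sum w S - x"] Y.nrm_nonneg[of "(sum z S - y) + (sum w S - x)"]
        by (simp only: Y.add_mem real_norm_def abs_of_nonneg)
    qed
  qed
qed

lemma sums_to_smult:
  assumes z: "z \<in> carrier X" "sums_to z y"
  shows "sums_to (smult X c z) (smult Y c y)"
  unfolding sums_to_def
proof
  have c: "y \<in> carrier Y"
    using z by (auto simp: sums_to_def)
  then show "smult Y c y \<in> carrier Y" by simp
  have "((\<lambda>S. cmod c * nrm Y (sum z S - y)) \<longlongrightarrow> 0) (finite_subsets_at_top A)"
    using z unfolding sums_to_def by (intro tendsto_mult_right_zero) auto
  moreover have "eventually (\<lambda>S. cmod c * nrm Y (sum z S - y) = nrm Y (sum (smult X c z) S - smult Y c y))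
      (finite_subsets_at_top A)"
    using eventually_sum_mem[OF z(1)]
  proof eventually_elim
    case (elim S)
    have "sum (smult X c z) S - smult Y c y = smult Y c (sum z S - y)"
      by (simp add: ell1_smult Y.scale_right_diff_distrib Y.scale_sum_right)
    then show ?case
      using Y.nrm_smult[of "sum z S - y" c] elim c by simp
  qed
  ultimately show "((\<lambda>S. nrm Y (sum (smult X c z) S - smult Y c y)) \<longlongrightarrow> 0) (finite_subsets_at_top A)"
    by (rule Lim_transform_eventually)
qed

lemma sums_to_nrm:
  assumes z: "z \<in> carrier X" "sums_to z y"
  shows "nrm Y y \<le> nrm X z"
proof -
  have c: "y \<in> carrier Y"
    using z by (auto simp: sums_to_def)
  have "((\<lambda>S. nrm X z + nrm Y (sum z S - y)) \<longlongrightarrow> nrm X z + 0) (finite_subsets_at_top A)"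
    using z unfolding sums_to_def by (intro tendsto_add tendsto_const) auto
  moreover have "eventually (\<lambda>S. nrm Y y \<le> nrm X z + nrm Y (sum z S - y)) (finite_subsets_at_top A)"
  proof (rule eventually_finite_subsets_at_top_weakI)
    fix S assume S: "finite S" "S \<subseteq> A"
    have m: "sum z S \<in> carrier Y"
      using S by (auto intro!: Y.sum_mem ell1_component z)
    have "nrm Y (sum z S) \<le> (\<Sum>\<alpha>\<in>S. nrm Y (z \<alpha>))"
      using S by (intro Y.nrm_sum) (auto intro!: ell1_component z)
    also have "\<dots> \<le> nrm X z"
      unfolding ell1_nrm using S
      by (intro finite_sum_le_infsum ell1_summable z) (auto intro!: Y.nrm_nonneg ell1_component z)
    finally show "nrm Y y \<le> nrm X z + nrm Y (sum z S - y)"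
      using Y.nrm_triangle_sub[OF c m] Y.nrm_minus_commute[OF c m] by simp
  qed
  ultimately have "nrm Y y \<le> nrm X z + 0"
    by (rule tendsto_lowerbound) simp
  then show ?thesis by simp
qed

text \<open>
  The absolute convergence makes the net of finite partial sums Cauchy. Completeness is about sequences, so the limit is
  found along finite sets \<open>S n\<close> whose tails have norm at most \<open>1/(n+1)\<close>, and then attracts all larger finite sets.
\<close>
lemma sums_to_exists:
  assumes complete: "Metric_space.mcomplete (carrier Y) (ndist Y)" and z: "z \<in> carrier X"
  shows "\<exists>y. sums_to z y"
proof -
  interpret M: Metric_space "carrier Y" "ndist Y" by (rule Y.Metric_space_ndist)
  have comp: "z \<alpha> \<in> carrier Y" if "\<alpha> \<in> A" for \<alpha>
    by (rule ell1_component[OF z that])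
  have mem: "sum z S \<in> carrier Y" if "S \<subseteq> A" for S
    using that comp by (intro Y.sum_mem) auto
  have "((\<lambda>S. \<Sum>\<alpha>\<in>S. nrm Y (z \<alpha>)) \<longlongrightarrow> nrm X z) (finite_subsets_at_top A)"
    using has_sum_infsum[OF ell1_summable[OF z]] by (simp add: ell1_nrm has_sum_def)
  then have "eventually (\<lambda>S. nrm X z - inverse (Suc n) < (\<Sum>\<alpha>\<in>S. nrm Y (z \<alpha>))) (finite_subsets_at_top A)" for n
    by (rule order_tendstoD(1)) simp
  then have "\<exists>S. finite S \<and> S \<subseteq> A \<and> nrm X z - inverse (Suc n) < (\<Sum>\<alpha>\<in>S. nrm Y (z \<alpha>))" for n
    unfolding eventually_finite_subsets_at_top by blast
  then obtain S where S: "\<And>n. finite (S n)" "\<And>n. S n \<subseteq> A"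
    and tail: "\<And>n. nrm X z - inverse (Suc n) < (\<Sum>\<alpha>\<in>S n. nrm Y (z \<alpha>))"
    by metis
  have close: "nrm Y (sum z T - sum z (S n)) \<le> inverse (Suc n)" if T: "finite T" "S n \<subseteq> T" "T \<subseteq> A" for T n
  proof -
    have "sum z T - sum z (S n) = sum z (T - S n)"
      using T by (simp add: sum_diff)
    also have "nrm Y \<dots> \<le> (\<Sum>\<alpha>\<in>T - S n. nrm Y (z \<alpha>))"
      using T comp by (intro Y.nrm_sum) auto
    also have "\<dots> = (\<Sum>\<alpha>\<in>T. nrm Y (z \<alpha>)) - (\<Sum>\<alpha>\<in>S n. nrm Y (z \<alpha>))"
      using T by (simp add: sum_diff)
    also have "(\<Sum>\<alpha>\<in>T. nrm Y (z \<alpha>)) \<le> nrm X z"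
      unfolding ell1_nrm using T comp
      by (intro finite_sum_le_infsum ell1_summable z) (auto intro!: Y.nrm_nonneg)
    finally show ?thesis using tail[of n] by simp
  qed
  have cauchy: "nrm Y (sum z (S m) - sum z (S n)) \<le> inverse (Suc m) + inverse (Suc n)" for m n
  proof -
    define U where "U = S m \<union> S n"
    have U: "finite U" "S m \<subseteq> U" "S n \<subseteq> U" "U \<subseteq> A"
      using S by (auto simp: U_def)
    show ?thesis
      using Y.nrm_triangle3[OF mem[OF S(2)[of m]] mem[OF U(4)] mem[OF S(2)[of n]]]
        Y.nrm_minus_commute[OF mem[OF S(2)[of m]] mem[OF U(4)]]
        close[OF U(1,2,4)] close[OF U(1,3,4)] by simp
  qed
  have inv0: "(\<lambda>n. inverse (real (Suc n))) \<longlonglongrightarrow> 0"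
    by (rule LIMSEQ_inverse_real_of_nat)
  have "M.MCauchy (\<lambda>n. sum z (S n))"
    unfolding M.MCauchy_def
  proof (intro conjI allI impI)
    show "range (\<lambda>n. sum z (S n)) \<subseteq> carrier Y"
      using mem S by auto
    fix e :: real assume "e > 0"
    then have "eventually (\<lambda>n. inverse (real (Suc n)) < e / 2) sequentially"
      by (intro order_tendstoD(2)[OF inv0]) simp
    then obtain K where K: "\<And>n. n \<ge> K \<Longrightarrow> inverse (real (Suc n)) < e / 2"
      by (auto simp: eventually_sequentially)
    show "\<exists>K. \<forall>n n'. K \<le> n \<longrightarrow> K \<le> n' \<longrightarrow> ndist Y (sum z (S n)) (sum z (S n')) < e"
    proof (intro exI[of _ K] allI impI)
      fix m n assume "K \<le> m" "K \<le> n"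
      then show "ndist Y (sum z (S m)) (sum z (S n)) < e"
        using cauchy[of m n] K[of m] K[of n] mem S(2) by (simp add: ndist_def)
    qed
  qed
  then obtain y where y: "limitin M.mtopology (\<lambda>n. sum z (S n)) y sequentially"
    using complete unfolding M.mcomplete_def by blast
  then have yc: "y \<in> carrier Y" and "((\<lambda>n. ndist Y (sum z (S n)) y) \<longlongrightarrow> 0) sequentially"
    by (auto simp: M.limitin_metric_dist_null)
  then have lim: "((\<lambda>n. nrm Y (sum z (S n) - y)) \<longlongrightarrow> 0) sequentially"
    using mem[OF S(2)] by (simp add: ndist_def)
  have "((\<lambda>S. nrm Y (sum z S - y)) \<longlongrightarrow> 0) (finite_subsets_at_top A)"
  proof (rule tendstoI)
    fix e :: real assume "e > 0"
    then have "eventually (\<lambda>n. inverse (real (Suc n)) < e / 2 \<and> nrm Y (sum z (S n) - y) < e / 2) sequentially"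
      by (intro eventually_conj order_tendstoD(2)[OF inv0] order_tendstoD(2)[OF lim]) simp_all
    then obtain n where n: "inverse (real (Suc n)) < e / 2" "nrm Y (sum z (S n) - y) < e / 2"
      by (auto simp: eventually_sequentially)
    show "eventually (\<lambda>T. dist (nrm Y (sum z T - y)) 0 < e) (finite_subsets_at_top A)"
      unfolding eventually_finite_subsets_at_top
    proof (intro exI[of _ "S n"] conjI allI impI S)
      fix T assume T: "finite T \<and> S n \<subseteq> T \<and> T \<subseteq> A"
      then have m: "sum z T \<in> carrier Y" by (intro mem) auto
      have "nrm Y (sum z T - y) < e"
        using Y.nrm_triangle3[OF m mem[OF S(2)[of n]] yc] close[of T n] T n by simp
      then show "dist (nrm Y (sum z T - y)) 0 < e"
        using Y.nrm_nonneg[OF Y.diff_mem[OF m yc]] by simp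
    qed
  qed
  then show ?thesis
    using yc by (auto simp: sums_to_def)
qed

section \<open>Near-best approximation\<close>

text \<open>
  A best approximation is replaced by an approximate one, with the tolerance carried in the index; its existence is
  then immediate from the definition of the infimum, and the tolerance vanishes in the limit.
\<close>
definition near :: "'a \<times> nat \<Rightarrow> 'y \<Rightarrow> 'y" where
  "near k y = (SOME v. v \<in> F (fst k) \<and>
     (\<forall>w\<in>F (fst k). nrm Y (v - y) \<le> nrm Y (w - y) + inverse (Suc (snd k))))"

lemma near:
  assumes \<alpha>: "\<alpha> \<in> A" and y: "y \<in> carrier Y"
  shows "near (\<alpha>, n) y \<in> F \<alpha>"
    and "w \<in> F \<alpha> \<Longrightarrow> nrm Y (near (\<alpha>, n) y - y) \<le> nrm Y (w - y) + inverse (Suc n)"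
proof -
  define D where "D = (\<lambda>w. nrm Y (w - y)) ` F \<alpha>"
  have "D \<noteq> {}" using Y.subspace_0[OF F_subspace[OF \<alpha>]] by (auto simp: D_def)
  moreover have bdd: "bdd_below D"
    using F_carrier[OF \<alpha>] y by (intro bdd_belowI[of _ 0]) (auto simp: D_def)
  moreover have "Inf D < Inf D + inverse (Suc n)" by simp
  ultimately have "\<exists>d\<in>D. d < Inf D + inverse (Suc n)"
    using cInf_less_iff by blast
  then obtain v where v: "v \<in> F \<alpha>" "nrm Y (v - y) < Inf D + inverse (Suc n)"
    unfolding D_def by blast
  have "\<exists>v. v \<in> F \<alpha> \<and> (\<forall>w\<in>F \<alpha>. nrm Y (v - y) \<le> nrm Y (w - y) + inverse (Suc n))"
  proof (intro exI[of _ v] conjI ballI v(1))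
    fix w assume "w \<in> F \<alpha>"
    then have "Inf D \<le> nrm Y (w - y)"
      using bdd by (intro cInf_lower) (auto simp: D_def)
    then show "nrm Y (v - y) \<le> nrm Y (w - y) + inverse (Suc n)"
      using v(2) by simp
  qed
  from someI_ex[OF this]
  show "near (\<alpha>, n) y \<in> F \<alpha>"
    and "w \<in> F \<alpha> \<Longrightarrow> nrm Y (near (\<alpha>, n) y - y) \<le> nrm Y (w - y) + inverse (Suc n)"
    by (auto simp: near_def)
qed

end

locale directed_dense_family = subspace_family Y A F
  for Y :: "('y::ab_group_add) cspace" and A :: "'a set" and F :: "'a \<Rightarrow> 'y set" +
  assumes complete: "Metric_space.mcomplete (carrier Y) (ndist Y)"
    and directed: "\<And>\<alpha> \<beta>. \<alpha> \<in> A \<Longrightarrow> \<beta> \<in> A \<Longrightarrow> \<exists>\<gamma>\<in>A. F \<alpha> \<subseteq> F \<gamma> \<and> F \<beta> \<subseteq> F \<gamma>"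
    and dense: "\<And>y e. y \<in> carrier Y \<Longrightarrow> e > 0 \<Longrightarrow> \<exists>\<alpha>\<in>A. \<exists>v\<in>F \<alpha>. nrm Y (v - y) < e"
begin

lemma sums_to_total: "z \<in> carrier X \<Longrightarrow> sums_to z (total z)"
  unfolding total_def by (rule someI_ex[OF sums_to_exists[OF complete]])

definition tails :: "'a filter" where
  "tails = (INF \<alpha>\<in>A. principal {\<gamma>\<in>A. F \<alpha> \<subseteq> F \<gamma>})"

lemma A_nonempty: "A \<noteq> {}"
  using dense[of 0 1] by auto

lemma eventually_tails: "eventually P tails \<longleftrightarrow> (\<exists>\<alpha>\<in>A. \<forall>\<gamma>\<in>A. F \<alpha> \<subseteq> F \<gamma> \<longrightarrow> P \<gamma>)"
  unfolding tails_def
proof (subst eventually_INF_base)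
  fix \<alpha> \<beta> assume "\<alpha> \<in> A" "\<beta> \<in> A"
  then obtain \<gamma> where "\<gamma> \<in> A" "F \<alpha> \<subseteq> F \<gamma>" "F \<beta> \<subseteq> F \<gamma>"
    using directed by blast
  then show "\<exists>\<gamma>\<in>A. principal {\<delta>\<in>A. F \<gamma> \<subseteq> F \<delta>}
      \<le> inf (principal {\<delta>\<in>A. F \<alpha> \<subseteq> F \<delta>}) (principal {\<delta>\<in>A. F \<beta> \<subseteq> F \<delta>})"
    by (intro bexI[of _ \<gamma>]) auto
qed (use A_nonempty in \<open>auto simp: eventually_principal\<close>)

lemma near_tendsto:
  assumes y: "y \<in> carrier Y"
  shows "((\<lambda>k. nrm Y (near k y - y)) \<longlongrightarrow> 0) (tails \<times>\<^sub>F sequentially)"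
proof (rule tendstoI)
  fix e :: real assume e: "e > 0"
  obtain \<alpha> v where v: "\<alpha> \<in> A" "v \<in> F \<alpha>" "nrm Y (v - y) < e / 2"
    using dense[OF y, of "e / 2"] e by auto
  have "eventually (\<lambda>n. inverse (real (Suc n)) < e / 2) sequentially"
    by (rule order_tendstoD(2)[OF LIMSEQ_inverse_real_of_nat]) (use e in simp)
  moreover have "eventually (\<lambda>\<gamma>. \<gamma> \<in> A \<and> F \<alpha> \<subseteq> F \<gamma>) tails"
    using v by (auto simp: eventually_tails)
  moreover have "dist (nrm Y (near (\<gamma>, n) y - y)) 0 < e"
    if "\<gamma> \<in> A \<and> F \<alpha> \<subseteq> F \<gamma>" "inverse (real (Suc n)) < e / 2" for \<gamma> n
  proof -
    have \<gamma>: "\<gamma> \<in> A" "v \<in> F \<gamma>" using that v by auto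
    have "near (\<gamma>, n) y - y \<in> carrier Y"
      using near(1)[OF \<gamma>(1) y] F_carrier[OF \<gamma>(1)] y by (intro Y.diff_mem) auto
    then show ?thesis
      using near(2)[OF \<gamma>(1) y \<gamma>(2), of n] v(3) that(2) by simp
  qed
  ultimately show "eventually (\<lambda>k. dist (nrm Y (near k y - y)) 0 < e) (tails \<times>\<^sub>F sequentially)"
    unfolding eventually_prod_filter by blast
qed

text \<open>
  All error terms of \<open>J\<close> are norms of vectors in a single coordinate, hence are computed in \<open>Y\<close> and are bounded by sums
  of approximation errors.
\<close>
lemma cluster_value_theorem_from_ell1_sum:
  assumes "satisfies_cluster_value_theorem H X"
  shows "satisfies_cluster_value_theorem H Y"
proof -
  have "tails \<noteq> bot"
    using A_nonempty directed by (auto simp: trivial_limit_def eventually_tails)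
  then have "tails \<times>\<^sub>F sequentially \<noteq> bot"
    by (simp add: prod_filter_eq_bot)
  then obtain N where N: "N \<le> tails \<times>\<^sub>F sequentially" "N \<noteq> bot"
    and conv: "\<And>u :: 'a \<times> nat \<Rightarrow> complex. bounded (range u) \<Longrightarrow> \<exists>l. (u \<longlongrightarrow> l) N"
    using convergence_deciding_filter[of "tails \<times>\<^sub>F sequentially"] by metis
  define J where "J k y = single (fst k) (near k y)" for k :: "'a \<times> nat" and y
  have index: "eventually (\<lambda>k. fst k \<in> A) N"
  proof (rule filter_leD[OF N(1)])
    show "eventually (\<lambda>k. fst k \<in> A) (tails \<times>\<^sub>F sequentially)"
      unfolding eventually_prod_filter
      using A_nonempty by (intro exI[of _ "\<lambda>\<alpha>. \<alpha> \<in> A"] exI[of _ "\<lambda>_. True"]) (auto simp: eventually_tails)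
  qed
  have near_F: "near k y \<in> F (fst k)" if "fst k \<in> A" "y \<in> carrier Y" for k y
    using near(1)[OF that, of "snd k"] by simp
  have near_c: "near k y \<in> carrier Y" if "fst k \<in> A" "y \<in> carrier Y" for k y
    using near_F[OF that] F_carrier[OF that(1)] by blast
  have lim: "((\<lambda>k. nrm Y (near k y - y)) \<longlongrightarrow> 0) N" if "y \<in> carrier Y" for y
    by (rule tendsto_mono[OF N(1) near_tendsto[OF that]])
  interpret R: asymptotic_retraction X Y N J total
  proof
    fix y assume y: "y \<in> carrier Y"
    show "eventually (\<lambda>k. J k y \<in> carrier X) N"
      using index by eventually_elim (use y near_F in \<open>auto simp: J_def intro!: single_mem\<close>)
    have "((\<lambda>k. nrm X (J k y) - nrm Y y) \<longlongrightarrow> 0) N"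
    proof (rule Lim_null_comparison[OF _ lim[OF y]])
      show "eventually (\<lambda>k. norm (nrm X (J k y) - nrm Y y) \<le> nrm Y (near k y - y)) N"
        using index
      proof eventually_elim
        case (elim k)
        note c = near_c[OF elim y]
        show ?case
          using Y.nrm_triangle_sub[OF c y] Y.nrm_triangle_sub[OF y c] Y.nrm_minus_commute[OF c y]
          by (simp add: J_def nrm_single[OF elim])
      qed
    qed
    then show "((\<lambda>k. nrm X (J k y)) \<longlongrightarrow> nrm Y y) N"
      by (simp add: LIM_zero_iff)
    have "eventually (\<lambda>k. nrm Y (near k y - y) = nrm Y (total (J k y) - y)) N"
      using index
    proof eventually_elim
      case (elim k)
      show ?case
        using total_eqI[OF single_mem sums_to_single, OF elim near_F[OF elim y] elim near_F[OF elim y]]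
        by (simp add: J_def)
    qed
    with lim[OF y] show "((\<lambda>k. nrm Y (total (J k y) - y)) \<longlongrightarrow> 0) N"
      by (rule Lim_transform_eventually)
  next
    fix y z assume y: "y \<in> carrier Y" and z: "z \<in> carrier Y"
    have yz: "y + z \<in> carrier Y" using y z by simp
    show "((\<lambda>k. nrm X (J k (y + z) - J k y - J k z)) \<longlongrightarrow> 0) N"
    proof (rule Lim_null_comparison)
      show "((\<lambda>k. nrm Y (near k (y + z) - (y + z)) + nrm Y (near k y - y) + nrm Y (near k z - z)) \<longlongrightarrow> 0) N"
        by (intro tendsto_add_zero lim y z yz)
      show "eventually (\<lambda>k. norm (nrm X (J k (y + z) - J k y - J k z))
          \<le> nrm Y (near k (y + z) - (y + z)) + nrm Y (near k y - y) + nrm Y (near k z - z)) N"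
        using index
      proof eventually_elim
        case (elim k)
        define a where "a = near k (y + z) - (y + z)"
        define b where "b = near k y - y"
        define c where "c = near k z - z"
        have m: "a \<in> carrier Y" "b \<in> carrier Y" "c \<in> carrier Y"
          unfolding a_def b_def c_def by (intro Y.diff_mem near_c elim y z yz)+
        have "J k (y + z) - J k y - J k z = single (fst k) (a - b - c)"
          by (simp add: J_def a_def b_def c_def flip: single_diff)
        moreover have "nrm Y (a - b - c) \<le> nrm Y a + nrm Y b + nrm Y c"
          using Y.nrm_add[of "a - b" "- c"] Y.nrm_add[of a "- b"] Y.nrm_minus[of b] Y.nrm_minus[of c] m
            Y.diff_mem[OF Y.zero_mem m(2)] Y.diff_mem[OF Y.zero_mem m(3)] by simp
        moreover have "0 \<le> nrm Y (a - b - c)"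
          by (intro Y.nrm_nonneg Y.diff_mem m)
        ultimately show ?case
          by (simp add: nrm_single[OF elim] a_def b_def c_def)
      qed
    qed
  next
    fix c y assume y: "y \<in> carrier Y"
    have cy: "smult Y c y \<in> carrier Y" using y by simp
    show "((\<lambda>k. nrm X (J k (smult Y c y) - smult X c (J k y))) \<longlongrightarrow> 0) N"
    proof (rule Lim_null_comparison)
      show "((\<lambda>k. nrm Y (near k (smult Y c y) - smult Y c y) + cmod c * nrm Y (near k y - y)) \<longlongrightarrow> 0) N"
        by (intro tendsto_add_zero tendsto_mult_right_zero lim y cy)
      show "eventually (\<lambda>k. norm (nrm X (J k (smult Y c y) - smult X c (J k y)))
          \<le> nrm Y (near k (smult Y c y) - smult Y c y) + cmod c * nrm Y (near k y - y)) N"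
        using index
      proof eventually_elim
        case (elim k)
        define a where "a = near k (smult Y c y) - smult Y c y"
        define b where "b = smult Y c (near k y) - smult Y c y"
        have m: "a \<in> carrier Y" "b \<in> carrier Y"
          unfolding a_def b_def by (intro Y.diff_mem Y.smult_mem near_c elim y cy)+
        have b: "nrm Y b = cmod c * nrm Y (near k y - y)"
          using Y.nrm_smult[OF Y.diff_mem[OF near_c[OF elim y] y], of c]
          by (simp add: b_def Y.scale_right_diff_distrib)
        have "J k (smult Y c y) - smult X c (J k y) = single (fst k) (a - b)"
          by (simp add: J_def a_def b_def flip: single_diff single_smult)
        moreover have "nrm Y (a - b) \<le> nrm Y a + nrm Y b"
          using Y.nrm_triangle3[OF m(1) Y.zero_mem m(2)] Y.nrm_minus[OF m(2)] by simp
        moreover have "0 \<le> nrm Y (a - b)"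
          by (intro Y.nrm_nonneg Y.diff_mem m)
        ultimately show ?case
          using b by (simp add: nrm_single[OF elim] a_def)
      qed
    qed
  next
    fix x assume x: "x \<in> carrier X"
    show "total x \<in> carrier Y"
      using sums_to_total[OF x] by (simp add: sums_to_def)
    show "nrm Y (total x) \<le> nrm X x"
      by (rule sums_to_nrm[OF x sums_to_total[OF x]])
    show "total (smult X c x) = smult Y c (total x)" for c
      by (intro total_eqI sums_to_smult sums_to_total X.smult_mem x)
    show "total (x + z) = total x + total z" if z: "z \<in> carrier X" for z
      by (intro total_eqI sums_to_add sums_to_total X.add_mem x z)
  qed (use N(2) conv in auto)
  show ?thesis
    by (rule R.cluster_value_theorem_transfer[OF assms])
qed

end

section \<open>The theorem\<close>

theorem mainTheorem3:
  fixes H :: ball_algebra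
    and Y :: "('y::ab_group_add) cspace"
    and A :: "'a set"
    and F :: "'a \<Rightarrow> 'y set"
  assumes "complex_banach_space Y"
    and "\<And>\<alpha>. \<alpha> \<in> A \<Longrightarrow> finite_dim_subspace Y (F \<alpha>)"
    and "\<And>\<alpha> \<beta>. \<alpha> \<in> A \<Longrightarrow> \<beta> \<in> A \<Longrightarrow> \<exists>\<gamma>\<in>A. F \<alpha> \<subseteq> F \<gamma> \<and> F \<beta> \<subseteq> F \<gamma>"
    and "Metric_space.mtopology (carrier Y) (ndist Y) closure_of (\<Union>\<alpha>\<in>A. F \<alpha>) = carrier Y"
    and "satisfies_cluster_value_theorem H (ell1_sum Y A F)"
  shows "satisfies_cluster_value_theorem H Y"
proof -
  interpret Y: normed_cspace Y
    using assms(1) by unfold_locales (simp add: complex_banach_space_def)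
  interpret M: Metric_space "carrier Y" "ndist Y" by (rule Y.Metric_space_ndist)
  interpret directed_dense_family Y A F
  proof
    fix y and e :: real assume y: "y \<in> carrier Y" and e: "e > 0"
    then have "\<exists>v\<in>\<Union>\<alpha>\<in>A. F \<alpha>. v \<in> M.mball y e"
      using assms(4) unfolding M.metric_closure_of by blast
    then show "\<exists>\<alpha>\<in>A. \<exists>v\<in>F \<alpha>. nrm Y (v - y) < e"
      by (force simp: ndist_def Y.nrm_minus_commute)
  qed (use assms in \<open>auto simp: finite_dim_subspace_def complex_banach_space_def\<close>)
  show ?thesis
    by (rule cluster_value_theorem_from_ell1_sum[OF assms(5)])
qed

end
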